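(* Let $\mathbf{A}$ be the navigation matrix (with possibly random entries) of a tenable continuum Pólya-like random walk $\mathbf{X}(t)=(X_1(t),\dots,X_c(t))^\top$. Then, at every time $t\ge 0$, the expected value of the coordinates of the walk is $$\mathbb{E}[\mathbf{X}(t)]=e^{\mathbb{E}[\mathbf{A}^\top]\,t}\,\mathbf{X}(0),$$ where $\mathbf{A}^\top$ is the transpose of $\mathbf{A}$, expectations are taken entrywise, and $e^{\mathbf{M}}=\sum_{n=0}^\infty \mathbf{M}^n/n!$ for a square matrix $\mathbf{M}$.
   Context: Continuum Pólya-like random walk. Fix $c\ge 1$, $C=\{1,\dots,c\}$, a deterministic starting vector $\mathbf{X}(0)\in\mathbb{R}^c$, and a navigation matrix $\mathbf{A}=(A_{i,j})_{i,j\in C}$ with real entries, which may be constants or random variables. The process $\mathbf{X}(t)=(X_1(t),\dots,X_c(t))^\top\in\mathbb{R}^c$ is the continuous-time pure jump process with the following dynamics. At any time $t$, given $\mathbf{X}(t)$, the next renewal (jump) occurs after an exponentially distributed waiting time with mean $1/\sum_{i\in C}X_i(t)$. Given that a renewal occurs, it is of type $i$ with probability $X_i(t)/\sum_{j\in C}X_j(t)$, where $\mathbf{X}(t)$ is the position just before the jump. At a renewal of type $i$, the amount $A_{i,j}$ is added to the $j$th coordinate, for every $j\in C$. If the entries of $\mathbf{A}$ are random, then at each renewal of type $i$ a fresh copy of the $i$th row of $\mathbf{A}$ is used, independent of the past and the current state of the process. Tenability (standing assumption): the starting values and the navigation matrix are such that the walk always avoids the origin and every coordinate always stays nonnegative.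 The joint moment generating functions $\psi_i(\mathbf{u})=\mathbb{E}[\exp(\sum_{j\in C}u_jA_{i,j})]$, $i\in C$, of the rows of $\mathbf{A}$ are assumed to be finite in a neighborhood of the origin. *)

theory Defs
  imports "HOL-Probability.Probability"
begin

(* On real^'n^'n the class operation "*" is entrywise multiplication, so "^" and "exp" are not
   available with their matrix meaning; powers are taken with respect to "**". *)
primrec mat_pow :: "real^'n^'n \<Rightarrow> nat \<Rightarrow> real^'n^'n" where
  "mat_pow B 0 = mat 1"
| "mat_pow B (Suc n) = B ** mat_pow B n"

definition mat_exp :: "real^'n^'n \<Rightarrow> real^'n^'n" where
  "mat_exp B = (\<Sum>n. mat_pow B n /\<^sub>R fact n)"

definition mean_vec :: "'a measure \<Rightarrow> ('a \<Rightarrow> real^'n) \<Rightarrow> real^'n" where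
  "mean_vec M V = (\<chi> j. \<integral>\<omega>. V \<omega> $ j \<partial>M)"

definition mean_mat :: "'a measure \<Rightarrow> ('a \<Rightarrow> real^'n^'m) \<Rightarrow> real^'n^'m" where
  "mean_mat M B = (\<chi> i j. \<integral>\<omega>. B \<omega> $ i $ j \<partial>M)"

(* The i-th row of the matrix A is the vector A $ i. The value may be infinite. *)
definition row_mgf :: "'b measure \<Rightarrow> ('b \<Rightarrow> real^'c^'c) \<Rightarrow> 'c \<Rightarrow> real^'c \<Rightarrow> ennreal" where
  "row_mgf N A i u = (\<integral>\<^sup>+\<eta>. ennreal (exp (\<Sum>j\<in>UNIV. u $ j * A \<eta> $ i $ j)) \<partial>N)"

definition row_mgfs_finite_near_0 :: "'b measure \<Rightarrow> ('b \<Rightarrow> real^'c^'c) \<Rightarrow> bool" where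
  "row_mgfs_finite_near_0 N A \<longleftrightarrow> (\<forall>i. \<forall>\<^sub>F u in nhds 0. row_mgf N A i u < \<infinity>)"

(* Renewals are numbered from 0: W n is the waiting time before renewal n, R n the vector that
   renewal n adds to the walk. So renewal_time W n and renewal_state x0 R n are the time at which
   the walk enters, and its position during, the n-th stretch between renewals (before renewal n). *)
definition renewal_time :: "(nat \<Rightarrow> 'a \<Rightarrow> real) \<Rightarrow> nat \<Rightarrow> 'a \<Rightarrow> real" where
  "renewal_time W n \<omega> = (\<Sum>k<n. W k \<omega>)"

definition renewal_state :: "real^'c \<Rightarrow> (nat \<Rightarrow> 'a \<Rightarrow> real^'c) \<Rightarrow> nat \<Rightarrow> 'a \<Rightarrow> real^'c" where
  "renewal_state x0 R n \<omega> = x0 + (\<Sum>k<n. R k \<omega>)"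

definition total :: "real^'c \<Rightarrow> real" where
  "total x = (\<Sum>i\<in>UNIV. x $ i)"

(* The walk X lives on M. The navigation matrix A lives on its own probability space N, since only
   the laws of its rows matter for the walk. J n is the type of renewal n, and F n is
   the history up to and including the first n renewals.

   renewal_law is the joint form of the dynamics: given the past, with x the current position, the
   waiting time is exponential with mean 1 / total x, independently of it the type is i with
   probability x $ i / total x, and given type i the added vector is a fresh copy of the i-th row.

   Explosion (infinitely many renewals in finite time) is not excluded by assumption: jump_process
   says nothing about X after an explosion time. *)
locale polya_walk =
  walk: prob_space M + nav: prob_space N + filtration "space M" F
  for M :: "'a measure" and N :: "'b measure" and A :: "'b \<Rightarrow> real^'c^'c" and x0 :: "real^'c"
    and F :: "nat \<Rightarrow> 'a measure" and W :: "nat \<Rightarrow> 'a \<Rightarrow> real" and J :: "nat \<Rightarrow> 'a \<Rightarrow> 'c"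
    and R :: "nat \<Rightarrow> 'a \<Rightarrow> real^'c" and X :: "real \<Rightarrow> 'a \<Rightarrow> real^'c" +
  assumes nav_measurable: "A \<in> borel_measurable N"
    and history_subalgebra: "\<And>n. subalgebra M (F n)"
    and wait_adapted: "\<And>n. W n \<in> borel_measurable (F (Suc n))"
    and type_adapted: "\<And>n. J n \<in> measurable (F (Suc n)) (count_space UNIV)"
    and row_adapted: "\<And>n. R n \<in> borel_measurable (F (Suc n))"
    and renewal_law: "\<And>n s i D. 0 \<le> s \<Longrightarrow> D \<in> sets borel \<Longrightarrow>
      AE \<omega> in M.
        real_cond_exp M (F n) (indicator {\<omega>' \<in> space M. s < W n \<omega>' \<and> J n \<omega>' = i \<and> R n \<omega>' \<in> D}) \<omega>
        = exp (- total (renewal_state x0 R n \<omega>) * s)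
          * (renewal_state x0 R n \<omega> $ i / total (renewal_state x0 R n \<omega>))
          * measure N {\<eta> \<in> space N. A \<eta> $ i \<in> D}"
    and walk_measurable: "\<And>t. 0 \<le> t \<Longrightarrow> X t \<in> borel_measurable M"
    and jump_process: "AE \<omega> in M. \<forall>n t.
      renewal_time W n \<omega> \<le> t \<and> t < renewal_time W (Suc n) \<omega> \<longrightarrow> X t \<omega> = renewal_state x0 R n \<omega>"

definition tenable :: "'a measure \<Rightarrow> real^'c \<Rightarrow> (nat \<Rightarrow> 'a \<Rightarrow> real^'c) \<Rightarrow> bool" where
  "tenable M x0 R \<longleftrightarrow>
    (AE \<omega> in M. \<forall>n. renewal_state x0 R n \<omega> \<noteq> 0 \<and> (\<forall>j. 0 \<le> renewal_state x0 R n \<omega> $ j))"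

end

theory Submission
  imports Defs
begin

text \<open>
  Write \<open>S k\<close> for the position of the walk during its \<open>k\<close>-th stretch, \<open>T k\<close> for the time at which
  that stretch begins, and \<open>B = \<E>[A\<^sup>T]\<close>. The idea is that \<open>m(t) = \<E>[X(t)]\<close> solves the linear
  integral equation \<open>m(t) = x0 + B (\<integral>\<^sub>0\<^sup>t m(s) ds)\<close>, whose only locally bounded solution is
  \<open>exp (t B) x0\<close>, by Picard iteration (\<open>linear_integral_equation_solution\<close>).

  The equation comes from one renewal at a time. Put
  \<open>occupation k i s = \<E>[S\<^sub>i k; T k \<le> s < T (k+1)]\<close>. Renewal \<open>k\<close> is of type \<open>i\<close> and occurs near
  time \<open>s\<close> at rate \<open>total (S k) * (S\<^sub>i k / total (S k)) = S\<^sub>i k\<close> while stretch \<open>k\<close> is running, and it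
  then adds a fresh copy of row \<open>i\<close>. Hence, for nonnegative \<open>h\<close>,
  \<open>\<E>[h (R k); J k = i, T (k+1) \<le> t] = (\<integral>\<^sub>0\<^sup>t occupation k i s ds) * \<E>[h (A\<^sub>i)]\<close>
  (\<open>renewal_flux\<close>). The total rate has cancelled, and this is why the mean satisfies a linear
  equation.

  Everything is summed over \<open>k\<close> with values in \<open>[0, \<infinity>]\<close>, so that the only analytic point is
  finiteness. The coordinates being nonnegative, their means are controlled by the mean of the total, and
  the total is at most its initial value plus the \<open>l1\<close> norms of the jumps so far. Truncated at \<open>n\<close> renewals, \<open>renewal_flux\<close> with \<open>h\<close> the \<open>l1\<close> norm then gives a Gronwall
  inequality whose constants do not depend on \<open>n\<close> (\<open>gronwall_ennreal\<close>, \<open>mean_le\<close>). This bound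
  serves twice. With \<open>h = 1\<close> it makes the expected number of renewals up to time \<open>t\<close> finite, so that
  the walk does not explode and \<open>X t\<close> is almost surely one of the \<open>S k\<close> (\<open>no_explosion\<close>). With
  \<open>h\<close> the positive or the negative part of a coordinate it makes both sides of
  \<open>X t + (sum of negative parts) = x0 + (sum of positive parts)\<close> have finite expectation
  (\<open>mean_balance\<close>), and subtraction yields the integral equation. The first moments of the
  entries of \<open>A\<close> that occur here are finite by the assumption on the moment generating functions.
\<close>

section \<open>The matrix exponential and linear integral equations\<close>

lemma mat_pow_scaleR: "mat_pow (t *\<^sub>R B) n = t ^ n *\<^sub>R mat_pow B n"
proof (induction n)
  case (Suc n)
  then show ?case
    by (simp add: matrix_matrix_mult_def vec_eq_iff sum_distrib_left mult_ac)
qed simp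

lemma abs_mat_pow_entry_le:
  fixes B :: "real^'n^'n"
  shows "\<bar>mat_pow B n $ i $ j\<bar> \<le> (\<Sum>i\<in>UNIV. \<Sum>j\<in>UNIV. \<bar>B $ i $ j\<bar>) ^ n"
proof (induction n arbitrary: i j)
  case 0
  then show ?case by (simp add: mat_def)
next
  case (Suc n)
  let ?\<beta> = "\<Sum>i\<in>UNIV. \<Sum>j\<in>UNIV. \<bar>B $ i $ j\<bar>"
  have "\<bar>mat_pow B (Suc n) $ i $ j\<bar> \<le> (\<Sum>k\<in>UNIV. \<bar>B $ i $ k * mat_pow B n $ k $ j\<bar>)"
    by (simp add: matrix_matrix_mult_def)
  also have "\<dots> \<le> (\<Sum>k\<in>UNIV. \<bar>B $ i $ k\<bar> * ?\<beta> ^ n)"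
    by (intro sum_mono) (auto simp: abs_mult intro!: mult_left_mono Suc.IH)
  also have "\<dots> = (\<Sum>k\<in>UNIV. \<bar>B $ i $ k\<bar>) * ?\<beta> ^ n"
    by (simp add: sum_distrib_right)
  also have "\<dots> \<le> ?\<beta> * ?\<beta> ^ n"
    by (intro mult_right_mono member_le_sum[of i UNIV "\<lambda>i. \<Sum>k\<in>UNIV. \<bar>B $ i $ k\<bar>"] zero_le_power sum_nonneg) 
      (auto intro: sum_nonneg)
  finally show ?case by simp
qed

lemma summable_mat_exp: "summable (\<lambda>n. mat_pow B n /\<^sub>R fact n)" for B :: "real^'n^'n"
proof (rule summable_comparison_test')
  let ?\<beta> = "\<Sum>i\<in>UNIV. \<Sum>j\<in>UNIV. \<bar>B $ i $ j\<bar>"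
  let ?c = "real CARD('n) * real CARD('n)"
  show "summable (\<lambda>n. ?c * (?\<beta> ^ n /\<^sub>R fact n))"
    by (intro summable_mult summable_exp_generic)
  show "norm (mat_pow B n /\<^sub>R fact n) \<le> ?c * (?\<beta> ^ n /\<^sub>R fact n)" for n
  proof -
    have "norm (mat_pow B n) \<le> (\<Sum>i\<in>UNIV. norm (mat_pow B n $ i))"
      unfolding norm_vec_def by (rule L2_set_le_sum) simp
    also have "\<dots> \<le> (\<Sum>i\<in>UNIV. \<Sum>j\<in>UNIV. \<bar>mat_pow B n $ i $ j\<bar>)"
      by (intro sum_mono norm_le_l1_cart)
    also have "\<dots> \<le> (\<Sum>i\<in>(UNIV::'n set). \<Sum>j\<in>(UNIV::'n set). ?\<beta> ^ n)"
      by (intro sum_mono abs_mat_pow_entry_le)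
    finally show ?thesis by (simp add: field_simps)
  qed
qed

lemma mat_exp_mult_sums:
  fixes B :: "real^'n^'n"
  shows "(\<lambda>n. t ^ n / fact n * (mat_pow B n *v x) $ j) sums ((mat_exp (t *\<^sub>R B) *v x) $ j)"
proof -
  have "(\<lambda>n. mat_pow (t *\<^sub>R B) n /\<^sub>R fact n) sums mat_exp (t *\<^sub>R B)"
    unfolding mat_exp_def by (rule summable_sums[OF summable_mat_exp])
  then have "(\<lambda>n. (mat_pow (t *\<^sub>R B) n /\<^sub>R fact n) $ j $ i) sums (mat_exp (t *\<^sub>R B) $ j $ i)" for i
    by (intro bounded_linear.sums[OF bounded_linear_vec_nth])
  then have "(\<lambda>n. \<Sum>i\<in>UNIV. (mat_pow (t *\<^sub>R B) n /\<^sub>R fact n) $ j $ i * x $ i)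
      sums (\<Sum>i\<in>UNIV. mat_exp (t *\<^sub>R B) $ j $ i * x $ i)"
    by (intro sums_sum sums_mult2)
  then show ?thesis
    by (simp add: matrix_vector_mult_def mat_pow_scaleR sum_distrib_left field_simps)
qed

lemma set_lebesgue_integral_power:
  "0 \<le> (t::real) \<Longrightarrow> (LINT s:{0..t}|lborel. s ^ k) = t ^ Suc k / real (Suc k)"
  using integral_power[of 0 t k] by (simp add: set_lebesgue_integral_def mult.commute)

lemma set_integrable_power [simp]: "set_integrable lborel {0..t::real} (\<lambda>s. s ^ k)"
  by (intro borel_integrable_atLeastAtMost') (auto intro!: continuous_intros)

lemma set_lebesgue_integral_sum:
  fixes f :: "'i \<Rightarrow> 'a \<Rightarrow> real"
  assumes "\<And>k. k \<in> I \<Longrightarrow> set_integrable M S (f k)"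
  shows "set_integrable M S (\<lambda>s. \<Sum>k\<in>I. f k s)"
    and "(LINT s:S|M. (\<Sum>k\<in>I. f k s)) = (\<Sum>k\<in>I. LINT s:S|M. f k s)"
  using assms by (simp_all add: set_integrable_def set_lebesgue_integral_def sum_distrib_left)

text \<open>Each application of the integral equation to the remainder against the truncated exponential series
  gains one integration, and so one more factor \<open>t / n\<close>. The constant multiplying \<open>t\<close> is the sum of
  all \<open>\<bar>B\<^sub>i\<^sub>j\<bar>\<close>, which dominates every row sum.\<close>
lemma picard_iteration:
  fixes g :: "real \<Rightarrow> real^'n" and B :: "real^'n^'n"
  assumes int: "\<And>i t. t \<le> b \<Longrightarrow> set_integrable lborel {0..t} (\<lambda>s. g s $ i)"
    and bounded: "\<And>i t. 0 \<le> t \<Longrightarrow> t \<le> b \<Longrightarrow> \<bar>g t $ i\<bar> \<le> K"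
    and eq: "\<And>j t. 0 \<le> t \<Longrightarrow> t \<le> b \<Longrightarrow>
      g t $ j = x $ j + (\<Sum>i\<in>UNIV. B $ j $ i * (LINT s:{0..t}|lborel. g s $ i))"
    and t: "0 \<le> t" "t \<le> b"
  shows "\<bar>g t $ j - (\<Sum>k<n. t ^ k / fact k * (mat_pow B k *v x) $ j)\<bar>
    \<le> K * ((\<Sum>i\<in>UNIV. \<Sum>j\<in>UNIV. \<bar>B $ i $ j\<bar>) * t) ^ n / fact n"
  using t
proof (induction n arbitrary: t j)
  case 0
  then show ?case using bounded by simp
next
  case (Suc n)
  let ?\<beta> = "\<Sum>i\<in>UNIV. \<Sum>j\<in>UNIV. \<bar>B $ i $ j\<bar>"
  let ?v = "\<lambda>k. mat_pow B k *v x"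
  let ?P = "\<lambda>n s i. \<Sum>k<n. s ^ k / fact k * ?v k $ i"
  have "0 \<le> K" using bounded[of t] Suc.prems by (meson abs_ge_zero order_trans)
  have \<beta>: "0 \<le> ?\<beta>" by (intro sum_nonneg) auto
  have intP: "set_integrable lborel {0..t} (\<lambda>s. ?P n s i)" for i
    by (intro set_lebesgue_integral_sum(1)) simp
  have P_Suc: "?P (Suc n) t j = x $ j + (\<Sum>i\<in>UNIV. B $ j $ i * (LINT s:{0..t}|lborel. ?P n s i))"
  proof -
    have 1: "(LINT s:{0..t}|lborel. ?P n s i) = (\<Sum>k<n. t ^ Suc k / fact (Suc k) * ?v k $ i)" for i
    proof -
      have "(LINT s:{0..t}|lborel. ?P n s i) = (\<Sum>k<n. (LINT s:{0..t}|lborel. s ^ k / fact k * ?v k $ i))"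
        by (intro set_lebesgue_integral_sum(2)) simp
      also have "\<dots> = (\<Sum>k<n. t ^ Suc k / fact (Suc k) * ?v k $ i)"
        using Suc.prems by (intro sum.cong) (auto simp: set_lebesgue_integral_power field_simps)
      finally show ?thesis .
    qed
    have 2: "(\<Sum>i\<in>UNIV. B $ j $ i * ?v k $ i) = ?v (Suc k) $ j" for k
      by (simp add: matrix_vector_mul_assoc[symmetric]) (simp add: matrix_vector_mult_def)
    have "(\<Sum>i\<in>UNIV. B $ j $ i * (LINT s:{0..t}|lborel. ?P n s i))
        = (\<Sum>k<n. t ^ Suc k / fact (Suc k) * (\<Sum>i\<in>UNIV. B $ j $ i * ?v k $ i))"
      unfolding 1 sum_distrib_left by (subst sum.swap) (auto intro!: sum.cong simp: field_simps)
    then show ?thesis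
      unfolding 2 by (simp add: sum.lessThan_Suc_shift del: sum.lessThan_Suc)
  qed
  have R: "\<bar>LINT s:{0..t}|lborel. g s $ i - ?P n s i\<bar> \<le> K * ?\<beta> ^ n * t ^ Suc n / fact (Suc n)" for i
  proof -
    have "\<bar>LINT s:{0..t}|lborel. g s $ i - ?P n s i\<bar> \<le> (LINT s:{0..t}|lborel. \<bar>g s $ i - ?P n s i\<bar>)"
      using set_integral_norm_bound[OF set_integral_diff(1)[OF int[OF Suc.prems(2)] intP]]
      by simp
    also have "\<dots> \<le> (LINT s:{0..t}|lborel. K * ?\<beta> ^ n / fact n * s ^ n)"
      using Suc.IH[of _ i] Suc.prems
      by (intro set_integral_mono set_integrable_abs set_integral_diff(1)[OF int intP])
        (auto simp: power_mult_distrib field_simps)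
    also have "\<dots> = K * ?\<beta> ^ n * t ^ Suc n / fact (Suc n)"
      using Suc.prems by (simp add: set_lebesgue_integral_power field_simps)
    finally show ?thesis .
  qed
  have "g t $ j - ?P (Suc n) t j
      = (\<Sum>i\<in>UNIV. B $ j $ i * (LINT s:{0..t}|lborel. g s $ i - ?P n s i))"
    unfolding P_Suc eq[OF Suc.prems] 
    by (subst set_integral_diff(2)[OF int[OF Suc.prems(2)] intP])
      (simp add: right_diff_distrib sum_subtractf)
  also have "\<bar>\<dots>\<bar> \<le> (\<Sum>i\<in>UNIV. \<bar>B $ j $ i * (LINT s:{0..t}|lborel. g s $ i - ?P n s i)\<bar>)"
    by (rule sum_abs)
  also have "\<dots> \<le> (\<Sum>i\<in>UNIV. \<bar>B $ j $ i\<bar> * (K * ?\<beta> ^ n * t ^ Suc n / fact (Suc n)))"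
    unfolding abs_mult by (intro sum_mono mult_left_mono R) auto
  also have "\<dots> = (\<Sum>i\<in>UNIV. \<bar>B $ j $ i\<bar>) * (K * ?\<beta> ^ n * t ^ Suc n / fact (Suc n))"
    by (rule sum_distrib_right[symmetric])
  also have "\<dots> \<le> ?\<beta> * (K * ?\<beta> ^ n * t ^ Suc n / fact (Suc n))"
    using \<open>0 \<le> K\<close> \<beta> Suc.prems
    by (intro mult_right_mono member_le_sum[of j UNIV "\<lambda>i. \<Sum>k\<in>UNIV. \<bar>B $ i $ k\<bar>"] 
         divide_nonneg_pos mult_nonneg_nonneg zero_le_power)
      (auto intro: sum_nonneg)
  finally show ?case by (simp add: power_mult_distrib field_simps)
qed

lemma linear_integral_equation_solution:
  fixes g :: "real \<Rightarrow> real^'n" and B :: "real^'n^'n"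
  assumes int: "\<And>i t. t \<le> b \<Longrightarrow> set_integrable lborel {0..t} (\<lambda>s. g s $ i)"
    and bounded: "\<And>i t. 0 \<le> t \<Longrightarrow> t \<le> b \<Longrightarrow> \<bar>g t $ i\<bar> \<le> K"
    and eq: "\<And>j t. 0 \<le> t \<Longrightarrow> t \<le> b \<Longrightarrow>
      g t $ j = x $ j + (\<Sum>i\<in>UNIV. B $ j $ i * (LINT s:{0..t}|lborel. g s $ i))"
    and t: "0 \<le> t" "t \<le> b"
  shows "g t = mat_exp (t *\<^sub>R B) *v x"
proof (rule vec_eq_iff[THEN iffD2], rule allI)
  fix j
  let ?\<beta> = "\<Sum>i\<in>UNIV. \<Sum>j\<in>UNIV. \<bar>B $ i $ j\<bar>"
  have "(\<lambda>n. K * ((?\<beta> * t) ^ n /\<^sub>R fact n)) \<longlonglongrightarrow> K * 0"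
    by (intro tendsto_mult_left summable_LIMSEQ_zero summable_exp_generic)
  then have "(\<lambda>n. K * (?\<beta> * t) ^ n / fact n) \<longlonglongrightarrow> 0" by (simp add: field_simps)
  then have "(\<lambda>n. g t $ j - (\<Sum>k<n. t ^ k / fact k * (mat_pow B k *v x) $ j)) \<longlonglongrightarrow> 0"
    by (rule Lim_null_comparison[rotated])
      (use picard_iteration[OF int bounded eq t] in auto)
  then have "(\<lambda>n. g t $ j - (g t $ j - (\<Sum>k<n. t ^ k / fact k * (mat_pow B k *v x) $ j))) \<longlonglongrightarrow> g t $ j - 0"
    by (intro tendsto_diff tendsto_const)
  then have "(\<lambda>k. t ^ k / fact k * (mat_pow B k *v x) $ j) sums (g t $ j)"
    by (simp add: sums_def)
  with mat_exp_mult_sums show "g t $ j = (mat_exp (t *\<^sub>R B) *v x) $ j"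
    by (rule sums_unique2[symmetric])
qed

section \<open>A Gronwall inequality for extended nonnegative functions\<close>

lemma nn_integral_exp_Icc:
  assumes "0 < c" "0 \<le> t"
  shows "(\<integral>\<^sup>+s\<in>{0..t}. ennreal (exp (c * s)) \<partial>lborel) = ennreal ((exp (c * t) - 1) / c)"
proof -
  have "(\<integral>\<^sup>+s\<in>{0..t}. ennreal (exp (c * s)) \<partial>lborel) = ennreal (exp (c * t) / c - exp (c * 0) / c)"
    using assms by (intro nn_integral_FTC_Icc) (auto intro!: derivative_eq_intros)
  then show ?thesis by (simp add: diff_divide_distrib)
qed

text \<open>Let \<open>V\<close> be the supremum of \<open>g s\<close> weighted by \<open>exp (- 2 b s)\<close>. Inserting \<open>g s \<le> V exp (2 b s)\<close> into
  the inequality gives back \<open>V \<le> x + V / 2\<close>, because the exponent \<open>2 b\<close> makes the integral operator a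
  contraction with factor \<open>1/2\<close>. The bound \<open>K\<close> serves only to make \<open>V\<close> finite, so that \<open>V / 2\<close> can be
  subtracted; the conclusion does not depend on its size.\<close>
lemma gronwall_ennreal:
  fixes g :: "real \<Rightarrow> ennreal"
  assumes [measurable]: "g \<in> borel_measurable borel"
    and ineq: "\<And>t. 0 \<le> t \<Longrightarrow> g t \<le> ennreal x + ennreal b * (\<integral>\<^sup>+s\<in>{0..t}. g s \<partial>lborel)"
    and bounded: "\<And>t. 0 \<le> t \<Longrightarrow> g t \<le> ennreal K"
    and b: "0 < b" and x: "0 \<le> x" and t: "0 \<le> t"
  shows "g t \<le> ennreal (2 * x * exp (2 * b * t))"
proof -
  define V where "V = (SUP s\<in>{0..}. g s * ennreal (exp (- (2 * b * s))))"
  have "V \<le> ennreal K"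
    unfolding V_def
  proof (rule SUP_least)
    fix s :: real assume "s \<in> {0..}"
    then have "g s * ennreal (exp (- (2 * b * s))) \<le> ennreal K * 1"
      using b bounded[of s] by (intro mult_mono) auto
    then show "g s * ennreal (exp (- (2 * b * s))) \<le> ennreal K" by simp
  qed
  then obtain v where v: "V = ennreal v" "0 \<le> v"
    by (metis ennreal_cases ennreal_less_top not_le)
  have le: "g s \<le> ennreal (v * exp (2 * b * s))" if "0 \<le> s" for s
  proof -
    have "g s * ennreal (exp (- (2 * b * s))) * ennreal (exp (2 * b * s)) \<le> V * ennreal (exp (2 * b * s))"
      using that unfolding V_def by (intro mult_right_mono SUP_upper) auto
    then show ?thesis
      by (simp add: mult.assoc ennreal_mult[symmetric] v exp_add[symmetric])
  qed
  have step: "g s * ennreal (exp (- (2 * b * s))) \<le> ennreal (x + v / 2)" if s: "0 \<le> s" for s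
  proof -
    have "(\<integral>\<^sup>+r\<in>{0..s}. g r \<partial>lborel) \<le> (\<integral>\<^sup>+r. ennreal v * (ennreal (exp (2 * b * r)) * indicator {0..s} r) \<partial>lborel)"
      using le v by (intro nn_integral_mono) (auto simp: indicator_def ennreal_mult)
    also have "\<dots> = ennreal v * ennreal ((exp (2 * b * s) - 1) / (2 * b))"
      using b s by (subst nn_integral_cmult) (auto simp: nn_integral_exp_Icc)
    also have "\<dots> \<le> ennreal (v * exp (2 * b * s) / (2 * b))"
      using b s v by (subst ennreal_mult'[symmetric]) (auto intro!: ennreal_leI divide_right_mono mult_left_mono simp: field_simps)
    finally have "g s \<le> ennreal x + ennreal b * ennreal (v * exp (2 * b * s) / (2 * b))"
      using ineq[OF s] by (meson add_left_mono mult_left_mono order_trans zero_le)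
    also have "\<dots> = ennreal (x + v * exp (2 * b * s) / 2)"
      using b v x by (subst ennreal_mult'[symmetric]) (auto simp: ennreal_plus[symmetric] simp del: ennreal_plus)
    finally have "g s * ennreal (exp (- (2 * b * s))) \<le> ennreal (x + v * exp (2 * b * s) / 2) * ennreal (exp (- (2 * b * s)))"
      by (rule mult_right_mono) simp
    also have "\<dots> = ennreal ((x + v * exp (2 * b * s) / 2) * exp (- (2 * b * s)))"
      using v x by (intro ennreal_mult[symmetric]) auto
    also have "\<dots> \<le> ennreal (x + v / 2)"
    proof (rule ennreal_leI)
      have "(x + v * exp (2 * b * s) / 2) * exp (- (2 * b * s)) = x * exp (- (2 * b * s)) + v / 2"
        by (simp add: distrib_right exp_minus field_simps)
      also have "\<dots> \<le> x * 1 + v / 2"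
        using x b s by (intro add_right_mono mult_left_mono) auto
      finally show "(x + v * exp (2 * b * s) / 2) * exp (- (2 * b * s)) \<le> x + v / 2" by simp
    qed
    finally show ?thesis .
  qed
  have "V \<le> ennreal (x + v / 2)"
    unfolding V_def by (rule SUP_least) (use step in auto)
  then have "v \<le> x + v / 2"
    using v x by (subst (asm) v, subst (asm) ennreal_le_iff) auto
  then have "v \<le> 2 * x" by simp
  then have "v * exp (2 * b * t) \<le> 2 * x * exp (2 * b * t)" by (intro mult_right_mono) auto
  then show ?thesis using le[OF t] by (meson ennreal_leI order_trans)
qed

lemma suminf_ennreal_const_1: "(\<Sum>k::nat. 1 :: ennreal) = \<infinity>"
proof (rule ccontr)
  assume "(\<Sum>k::nat. 1 :: ennreal) \<noteq> \<infinity>"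
  then obtain n where n: "(\<Sum>k::nat. 1 :: ennreal) < of_nat n"
    using ennreal_Ex_less_of_nat[of "\<Sum>k::nat. 1"] by (auto simp: less_top)
  have "(\<Sum>k<n. 1 :: ennreal) \<le> (\<Sum>k. 1)" by (intro sum_le_suminf) auto
  with n show False by simp
qed

section \<open>The joint law of a renewal\<close>

lemma measurable_vec_nth [measurable (raw)]:
  fixes f :: "'a \<Rightarrow> 'b::topological_space^'n"
  assumes "f \<in> borel_measurable M"
  shows "(\<lambda>x. f x $ i) \<in> borel_measurable M"
  by (rule measurable_compose[OF assms]) (intro borel_measurable_continuous_onI continuous_intros)

lemma measurable_total [measurable (raw)]:
  "f \<in> borel_measurable M \<Longrightarrow> (\<lambda>x. total (f x)) \<in> borel_measurable M"
  unfolding total_def by measurable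

text \<open>The maximum makes the formula cover negative \<open>s\<close>, where the tail is the full mass. All rays
  \<open>{s<..}\<close> are needed to identify a law on the real line from its tails.\<close>
lemma exponential_density_tail:
  assumes "0 < l"
  shows "(\<integral>\<^sup>+w. ennreal (exponential_density l w) * indicator {s<..} w \<partial>lborel)
    = ennreal (exp (- l * max 0 s))"
proof -
  have *: "(\<integral>\<^sup>+w. ennreal (exponential_density l w) * indicator {s<..} w \<partial>lborel)
      = (\<integral>\<^sup>+w. ennreal (l * exp (- w * l)) * indicator {max 0 s..} w \<partial>lborel)"
    using AE_lborel_singleton[of 0] AE_lborel_singleton[of s]
    by (intro nn_integral_cong_AE, eventually_elim) (auto simp: exponential_density_def indicator_def)
  have lim: "((\<lambda>w. - exp (- w * l)) \<longlongrightarrow> 0) at_top"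
    using assms by real_asymp
  have "(\<integral>\<^sup>+w. ennreal (l * exp (- w * l)) * indicator {max 0 s..} w \<partial>lborel)
      = ennreal (0 - (- exp (- max 0 s * l)))"
    using assms lim
    by (intro nn_integral_FTC_atLeast[where F = "\<lambda>w. - exp (- w * l)"])
       (auto intro!: derivative_eq_intros)
  then show ?thesis unfolding * by (simp add: mult.commute)
qed

text \<open>Tenability makes the total rate positive, so that the type probabilities are genuine probabilities;
  where the total is \<open>0\<close>, the quotient in \<open>renewal_law\<close> would be \<open>0\<close> by the convention for division.\<close>
locale tenable_polya_walk = polya_walk M N A x0 F W J R X
  for M :: "'a measure" and N :: "'b measure" and A :: "'b \<Rightarrow> real^'c^'c" and x0 :: "real^'c"
    and F :: "nat \<Rightarrow> 'a measure" and W :: "nat \<Rightarrow> 'a \<Rightarrow> real" and J :: "nat \<Rightarrow> 'a \<Rightarrow> 'c"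
    and R :: "nat \<Rightarrow> 'a \<Rightarrow> real^'c" and X :: "real \<Rightarrow> 'a \<Rightarrow> real^'c" +
  assumes tenable: "tenable M x0 R"
begin

abbreviation S where "S \<equiv> renewal_state x0 R"
abbreviation T where "T \<equiv> renewal_time W"

definition type_prob :: "nat \<Rightarrow> 'c \<Rightarrow> 'a \<Rightarrow> real" where
  "type_prob n i \<omega> = S n \<omega> $ i / total (S n \<omega>)"

lemma history_le: "m \<le> n \<Longrightarrow> subalgebra (F n) (F m)"
  using sets_F_mono[of m n] by (simp add: subalgebra_def space_F)

lemma space_history [simp]: "space (F n) = space M"
  using space_F by simp

lemma state_adapted [measurable]: "S n \<in> borel_measurable (F n)"
proof -
  have "R k \<in> borel_measurable (F n)" if "k < n" for k
    using that by (intro measurable_from_subalg[OF history_le row_adapted]) auto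
  then show ?thesis unfolding renewal_state_def by (intro borel_measurable_add borel_measurable_sum) auto
qed

lemma time_adapted [measurable]: "T n \<in> borel_measurable (F n)"
proof -
  have "W k \<in> borel_measurable (F n)" if "k < n" for k
    using that by (intro measurable_from_subalg[OF history_le wait_adapted]) auto
  then show ?thesis unfolding renewal_time_def by (intro borel_measurable_sum) auto
qed

lemma type_prob_adapted [measurable]: "type_prob n i \<in> borel_measurable (F n)"
  unfolding type_prob_def by measurable

lemmas history_measurable = measurable_from_subalg[OF history_subalgebra]

lemma walk_components_measurable [measurable]:
  "S n \<in> borel_measurable M" "T n \<in> borel_measurable M" "type_prob n i \<in> borel_measurable M"
  "W n \<in> borel_measurable M" "J n \<in> measurable M (count_space UNIV)" "R n \<in> borel_measurable M"
  by (rule history_measurable, rule state_adapted time_adapted type_prob_adapted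
      wait_adapted type_adapted row_adapted)+

declare nav_measurable [measurable]

lemma state_nonneg: "AE \<omega> in M. \<forall>n. S n \<omega> \<noteq> 0 \<and> (\<forall>j. 0 \<le> S n \<omega> $ j)"
  using tenable by (simp add: tenable_def)

lemma total_pos: "AE \<omega> in M. \<forall>n. 0 < total (S n \<omega>)"
  using state_nonneg
proof eventually_elim
  case (elim \<omega>)
  show ?case
  proof
    fix n
    from elim obtain i where "S n \<omega> $ i \<noteq> 0" by (auto simp: vec_eq_iff)
    with elim show "0 < total (S n \<omega>)"
      unfolding total_def by (intro sum_pos2[of _ i]) (auto simp: less_le)
  qed
qed

lemma type_prob_distribution:
  "AE \<omega> in M. \<forall>n. (\<forall>i. 0 \<le> type_prob n i \<omega>) \<and> (\<Sum>i\<in>UNIV. type_prob n i \<omega>) = 1"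
  using state_nonneg total_pos
proof eventually_elim
  case (elim \<omega>)
  then have "total (S n \<omega>) \<noteq> 0" for n by (metis less_irrefl)
  with elim show ?case
    by (auto simp: type_prob_def total_def sum_divide_distrib[symmetric] intro!: divide_nonneg_nonneg sum_nonneg)
qed

text \<open>The conditional law integrated over an event \<open>H\<close> of the past: conditional expectations disappear
  from here on.\<close>
lemma renewal_law_on_history:
  assumes "0 \<le> s" "D \<in> sets borel" "H \<in> sets (F n)"
  shows "emeasure M {\<omega>\<in>H. s < W n \<omega> \<and> J n \<omega> = i \<and> R n \<omega> \<in> D}
    = (\<integral>\<^sup>+\<omega>\<in>H. ennreal (type_prob n i \<omega> * exp (- total (S n \<omega>) * s)) \<partial>M)
      * emeasure N {\<eta>\<in>space N. A \<eta> $ i \<in> D}"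
proof -
  interpret sigma_finite_subalgebra M "F n"
    by (intro finite_measure_subalgebra_is_sigma_finite)
      (simp add: finite_measure_subalgebra_def finite_measure_subalgebra_axioms_def
        walk.finite_measure_axioms history_subalgebra)
  have HM [measurable]: "H \<in> sets M"
    using assms(3) history_subalgebra[of n] by (auto simp: subalgebra_def)
  note [measurable] = assms(2)
  let ?E = "{\<omega>\<in>space M. s < W n \<omega> \<and> J n \<omega> = i \<and> R n \<omega> \<in> D}"
  let ?\<mu> = "measure N {\<eta>\<in>space N. A \<eta> $ i \<in> D}"
  let ?c = "\<lambda>\<omega>. type_prob n i \<omega> * exp (- total (S n \<omega>) * s) * ?\<mu>"
  have E [measurable]: "?E \<in> sets M" by measurable
  have iE: "integrable M (indicator ?E :: _ \<Rightarrow> real)"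
    by (simp add: walk.emeasure_eq_measure)
  have law: "AE \<omega> in M. real_cond_exp M (F n) (indicator ?E) \<omega> = ?c \<omega>"
    using renewal_law[OF assms(1,2), of n i] by eventually_elim (simp add: type_prob_def)
  have "integrable M (real_cond_exp M (F n) (indicator ?E)) = integrable M ?c"
    using law by (intro integrable_cong_AE) auto
  with real_cond_exp_int(1)[OF iE] have ic: "integrable M ?c" by simp
  have HE: "{\<omega>\<in>H. s < W n \<omega> \<and> J n \<omega> = i \<and> R n \<omega> \<in> D} = H \<inter> ?E"
    using sets.sets_into_space[OF HM] by auto
  have "emeasure M (H \<inter> ?E) = ennreal (\<integral>\<omega>\<in>H. indicator ?E \<omega> \<partial>M)"
    by (simp add: walk.emeasure_eq_measure set_lebesgue_integral_def indicator_inter_arith[symmetric])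
  also have "(\<integral>\<omega>\<in>H. indicator ?E \<omega> \<partial>M) = (\<integral>\<omega>\<in>H. real_cond_exp M (F n) (indicator ?E) \<omega> \<partial>M)"
    by (rule real_cond_exp_intA[OF iE assms(3)])
  also have "\<dots> = (\<integral>\<omega>. indicator H \<omega> * ?c \<omega> \<partial>M)"
    unfolding set_lebesgue_integral_def using law by (intro integral_cong_AE) auto
  also have "ennreal \<dots> = (\<integral>\<^sup>+\<omega>. ennreal (indicator H \<omega> * ?c \<omega>) \<partial>M)"
    using integrable_mult_indicator[OF HM ic] type_prob_distribution
    by (intro nn_integral_eq_integral[symmetric]) (auto elim!: eventually_mono)
  also have "\<dots> = (\<integral>\<^sup>+\<omega>. (ennreal (type_prob n i \<omega> * exp (- total (S n \<omega>) * s)) * indicator H \<omega>) * ennreal ?\<mu> \<partial>M)"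
    by (intro nn_integral_cong) (auto simp: ennreal_mult'' split: split_indicator)
  also have "\<dots> = (\<integral>\<^sup>+\<omega>\<in>H. ennreal (type_prob n i \<omega> * exp (- total (S n \<omega>) * s)) \<partial>M) * ennreal ?\<mu>"
    by (intro nn_integral_multc) measurable
  finally show ?thesis unfolding HE by (simp add: nav.emeasure_eq_measure)
qed

text \<open>\<open>renewal_law\<close> says that the waiting time exceeds \<open>0\<close> with probability one once it is summed over all
  types: the type probabilities add up to one.\<close>
lemma waiting_time_pos: "AE \<omega> in M. \<forall>n. 0 < W n \<omega>"
proof (rule AE_all_countable[THEN iffD2], rule allI)
  fix n
  have "emeasure M {\<omega>\<in>space M. 0 < W n \<omega>}
      = emeasure M (\<Union>i. {\<omega>\<in>space M. 0 < W n \<omega> \<and> J n \<omega> = i \<and> R n \<omega> \<in> UNIV})"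
    by (rule arg_cong[where f = "emeasure M"]) auto
  also have "\<dots> = (\<Sum>i\<in>UNIV. emeasure M {\<omega>\<in>space M. 0 < W n \<omega> \<and> J n \<omega> = i \<and> R n \<omega> \<in> UNIV})"
    by (intro sum_emeasure[symmetric]) (auto simp: disjoint_family_on_def)
  also have "\<dots> = (\<Sum>i\<in>UNIV. \<integral>\<^sup>+\<omega>. ennreal (type_prob n i \<omega>) \<partial>M)"
    using renewal_law_on_history[of 0 UNIV "space M" n] sets.top[of "F n"]
    by (intro sum.cong) (auto simp: nav.emeasure_space_1 intro!: nn_integral_cong)
  also have "\<dots> = (\<integral>\<^sup>+\<omega>. (\<Sum>i\<in>UNIV. ennreal (type_prob n i \<omega>)) \<partial>M)"
    by (intro nn_integral_sum[symmetric]) measurable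
  also have "\<dots> = (\<integral>\<^sup>+\<omega>. 1 \<partial>M)"
    using type_prob_distribution by (intro nn_integral_cong_AE) (auto elim!: eventually_mono)
  also have "\<dots> = 1" by (simp add: walk.emeasure_space_1)
  finally have "walk.prob {\<omega>\<in>space M. 0 < W n \<omega>} = 1"
    by (simp add: measure_def)
  then show "AE \<omega> in M. 0 < W n \<omega>"
    by (subst (asm) walk.prob_Collect_eq_1) auto
qed

text \<open>For fixed \<open>H\<close>, \<open>i\<close> and \<open>D\<close>, both sides are finite measures in \<open>B\<close>. They agree on the rays \<open>{s<..}\<close>,
  for negative \<open>s\<close> because waiting times are positive, hence on all Borel sets.\<close>
lemma waiting_time_law_on_history:
  assumes D: "D \<in> sets borel" and H: "H \<in> sets (F n)" and "B \<in> sets borel"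
  shows "emeasure M {\<omega>\<in>H. W n \<omega> \<in> B \<and> J n \<omega> = i \<and> R n \<omega> \<in> D}
    = (\<integral>\<^sup>+\<omega>. \<integral>\<^sup>+w. indicator (H \<times> B) (\<omega>, w) * (ennreal (type_prob n i \<omega>)
        * ennreal (exponential_density (total (S n \<omega>)) w)) * emeasure N {\<eta>\<in>space N. A \<eta> $ i \<in> D} \<partial>lborel \<partial>M)"
proof -
  have HM [measurable]: "H \<in> sets M"
    using H history_subalgebra[of n] by (auto simp: subalgebra_def)
  note [measurable] = D
  define E where "E = {\<omega>\<in>H. J n \<omega> = i \<and> R n \<omega> \<in> D}"
  have "E = H \<inter> {\<omega>\<in>space M. J n \<omega> = i \<and> R n \<omega> \<in> D}"
    using sets.sets_into_space[OF HM] by (auto simp: E_def)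
  then have E [measurable]: "E \<in> sets M" by simp
  have Hs: "H \<subseteq> space M" using sets.sets_into_space[OF HM] .
  let ?\<mu> = "emeasure N {\<eta>\<in>space N. A \<eta> $ i \<in> D}"
  let ?f = "\<lambda>\<omega> w. indicator H \<omega> * (ennreal (type_prob n i \<omega>)
        * ennreal (exponential_density (total (S n \<omega>)) w)) * ?\<mu> :: ennreal"
  have [measurable]: "case_prod ?f \<in> borel_measurable (M \<Otimes>\<^sub>M lborel)"
    unfolding exponential_density_def by measurable
  define \<nu>1 where "\<nu>1 = distr (density M (indicator E)) borel (W n)"
  define \<nu>2 where "\<nu>2 = distr (density (M \<Otimes>\<^sub>M lborel) (case_prod ?f)) borel snd"
  have \<nu>1: "emeasure \<nu>1 B = emeasure M {\<omega>\<in>H. W n \<omega> \<in> B \<and> J n \<omega> = i \<and> R n \<omega> \<in> D}"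
    if [measurable]: "B \<in> sets borel" for B
  proof -
    have "emeasure \<nu>1 B = (\<integral>\<^sup>+\<omega>. indicator E \<omega> * indicator (W n -` B \<inter> space M) \<omega> \<partial>M)"
      unfolding \<nu>1_def by (simp add: emeasure_distr emeasure_density)
    also have "\<dots> = (\<integral>\<^sup>+\<omega>. indicator (E \<inter> (W n -` B \<inter> space M)) \<omega> \<partial>M)"
      by (simp add: indicator_inter_arith)
    also have "\<dots> = emeasure M (E \<inter> (W n -` B \<inter> space M))"
      by simp
    also have "E \<inter> (W n -` B \<inter> space M) = {\<omega>\<in>H. W n \<omega> \<in> B \<and> J n \<omega> = i \<and> R n \<omega> \<in> D}"
      using Hs by (auto simp: E_def)
    finally show ?thesis .
  qed
  have \<nu>2: "emeasure \<nu>2 B = (\<integral>\<^sup>+\<omega>. \<integral>\<^sup>+w. ?f \<omega> w * indicator B w \<partial>lborel \<partial>M)"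
    if [measurable]: "B \<in> sets borel" for B
  proof -
    have "emeasure \<nu>2 B = (\<integral>\<^sup>+p. case_prod ?f p * indicator (snd -` B \<inter> space (M \<Otimes>\<^sub>M lborel)) p \<partial>(M \<Otimes>\<^sub>M lborel))"
      unfolding \<nu>2_def by (simp add: emeasure_distr) (intro emeasure_density, measurable)
    also have "\<dots> = (\<integral>\<^sup>+p. case_prod (\<lambda>\<omega> w. ?f \<omega> w * indicator B w) p \<partial>(M \<Otimes>\<^sub>M lborel))"
      by (intro nn_integral_cong) (auto simp: space_pair_measure indicator_def)
    also have "\<dots> = (\<integral>\<^sup>+\<omega>. \<integral>\<^sup>+w. ?f \<omega> w * indicator B w \<partial>lborel \<partial>M)"
      by (subst lborel.nn_integral_fst[symmetric]) simp_all
    finally show ?thesis .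
  qed
  have "\<nu>1 = \<nu>2"
  proof (rule measure_eqI_lessThan)
    fix s :: real
    show "emeasure \<nu>1 {s<..} < \<infinity>"
      by (subst \<nu>1) (auto simp: walk.emeasure_eq_measure)
    have "emeasure \<nu>1 {s<..} = emeasure M {\<omega>\<in>H. s < W n \<omega> \<and> J n \<omega> = i \<and> R n \<omega> \<in> D}"
      by (simp add: \<nu>1)
    also have "\<dots> = emeasure M {\<omega>\<in>H. max 0 s < W n \<omega> \<and> J n \<omega> = i \<and> R n \<omega> \<in> D}"
    proof (rule emeasure_eq_AE)
      show "AE \<omega> in M. (\<omega> \<in> {\<omega>\<in>H. s < W n \<omega> \<and> J n \<omega> = i \<and> R n \<omega> \<in> D}) \<longleftrightarrow>
          (\<omega> \<in> {\<omega>\<in>H. max 0 s < W n \<omega> \<and> J n \<omega> = i \<and> R n \<omega> \<in> D})"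
        using waiting_time_pos by (auto elim!: eventually_mono)
      have "{\<omega>\<in>H. r < W n \<omega> \<and> J n \<omega> = i \<and> R n \<omega> \<in> D} = E \<inter> {\<omega>\<in>space M. r < W n \<omega>}" for r
        using Hs by (auto simp: E_def)
      then show "{\<omega>\<in>H. s < W n \<omega> \<and> J n \<omega> = i \<and> R n \<omega> \<in> D} \<in> sets M"
        "{\<omega>\<in>H. max 0 s < W n \<omega> \<and> J n \<omega> = i \<and> R n \<omega> \<in> D} \<in> sets M" by simp_all
    qed
    also have "\<dots> = (\<integral>\<^sup>+\<omega>\<in>H. ennreal (type_prob n i \<omega> * exp (- total (S n \<omega>) * max 0 s)) \<partial>M) * ?\<mu>"
      by (rule renewal_law_on_history[OF _ D H]) simp
    also have "\<dots> = (\<integral>\<^sup>+\<omega>. indicator H \<omega> * ennreal (type_prob n i \<omega>) * ennreal (exp (- total (S n \<omega>) * max 0 s)) * ?\<mu> \<partial>M)"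
      by (subst nn_integral_multc[symmetric]) (auto simp: ennreal_mult'' mult_ac intro!: nn_integral_cong)
    also have "\<dots> = (\<integral>\<^sup>+\<omega>. \<integral>\<^sup>+w. ?f \<omega> w * indicator {s<..} w \<partial>lborel \<partial>M)"
    proof (rule nn_integral_cong_AE)
      show "AE \<omega> in M. indicator H \<omega> * ennreal (type_prob n i \<omega>) * ennreal (exp (- total (S n \<omega>) * max 0 s)) * ?\<mu>
        = (\<integral>\<^sup>+w. ?f \<omega> w * indicator {s<..} w \<partial>lborel)"
        using total_pos
      proof eventually_elim
        case (elim \<omega>)
        have "(\<integral>\<^sup>+w. ?f \<omega> w * indicator {s<..} w \<partial>lborel)
          = (\<integral>\<^sup>+w. (indicator H \<omega> * ennreal (type_prob n i \<omega>) * ?\<mu>) *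
              (ennreal (exponential_density (total (S n \<omega>)) w) * indicator {s<..} w) \<partial>lborel)"
          by (intro nn_integral_cong) (simp add: mult_ac)
        also have "\<dots> = (indicator H \<omega> * ennreal (type_prob n i \<omega>) * ?\<mu>) * ennreal (exp (- total (S n \<omega>) * max 0 s))"
          using elim by (subst nn_integral_cmult) (auto simp: exponential_density_tail)
        finally show ?case by (simp add: mult_ac)
      qed
    qed
    also have "\<dots> = emeasure \<nu>2 {s<..}" by (simp add: \<nu>2)
    finally show "emeasure \<nu>1 {s<..} = emeasure \<nu>2 {s<..}" .
  qed (auto simp: \<nu>1_def \<nu>2_def)
  then show ?thesis
    using \<nu>1[OF assms(3)] \<nu>2[OF assms(3)] by (simp add: indicator_times mult_ac)
qed


lemma identity_measurable_history: "(\<lambda>\<omega>. \<omega>) \<in> measurable M (F n)"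
  using history_subalgebra[of n] sets.sets_into_space[of _ M]
  by (auto simp: measurable_def subalgebra_def Int_absorb2)

lemma identity_measurable_history_time: "(\<lambda>p. p) \<in> measurable (M \<Otimes>\<^sub>M lborel) (F n \<Otimes>\<^sub>M borel)"
  unfolding measurable_pair_iff o_def
  by (intro conjI measurable_compose[OF measurable_fst identity_measurable_history]) measurable

lemma history_time_measurable:
  assumes "f \<in> borel_measurable (F n \<Otimes>\<^sub>M borel)"
  shows "f \<in> borel_measurable (M \<Otimes>\<^sub>M lborel)"
  using measurable_compose[OF identity_measurable_history_time assms] .

text \<open>Integrands may depend jointly on the past and on the waiting time, as in \<open>T n + W n \<le> t\<close>. Rectangles
  \<open>H \<times> B\<close> are stable under intersection and generate the product \<open>\<sigma>\<close>-algebra, so the previous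
  lemma determines the law of \<open>\<omega> \<mapsto> (\<omega>, W n \<omega>)\<close> on it. Only \<open>F n\<close>, not the full \<open>\<sigma>\<close>-algebra of \<open>M\<close>, may be
  used in the first factor: the waiting time is exponential only given the past.\<close>
lemma waiting_time_integral:
  assumes f: "f \<in> borel_measurable (F n \<Otimes>\<^sub>M borel)" and D [measurable]: "D \<in> sets borel"
  shows "(\<integral>\<^sup>+\<omega>. f (\<omega>, W n \<omega>) * indicator {\<omega>. J n \<omega> = i \<and> R n \<omega> \<in> D} \<omega> \<partial>M)
    = (\<integral>\<^sup>+\<omega>. ennreal (type_prob n i \<omega>) *
          (\<integral>\<^sup>+w. f (\<omega>, w) * ennreal (exponential_density (total (S n \<omega>)) w) \<partial>lborel) \<partial>M)
      * emeasure N {\<eta>\<in>space N. A \<eta> $ i \<in> D}"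
proof -
  let ?\<mu> = "emeasure N {\<eta>\<in>space N. A \<eta> $ i \<in> D}"
  let ?g = "\<lambda>\<omega> w. ennreal (type_prob n i \<omega>) * ennreal (exponential_density (total (S n \<omega>)) w) * ?\<mu>"
  let ?E = "{\<omega>\<in>space M. J n \<omega> = i \<and> R n \<omega> \<in> D}"
  have g [measurable]: "case_prod ?g \<in> borel_measurable (M \<Otimes>\<^sub>M lborel)"
    unfolding exponential_density_def by measurable
  note fM [measurable] = history_time_measurable[OF f]
  have pw [measurable]: "(\<lambda>\<omega>. (\<omega>, W n \<omega>)) \<in> measurable M (F n \<Otimes>\<^sub>M borel)"
    by (intro measurable_Pair identity_measurable_history) measurable
  define \<nu>1 where "\<nu>1 = distr (density M (indicator ?E)) (F n \<Otimes>\<^sub>M borel) (\<lambda>\<omega>. (\<omega>, W n \<omega>))"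
  \<comment> \<open>The restriction of the product of \<open>M\<close> and \<open>lborel\<close> to the smaller \<open>\<sigma>\<close>-algebra is its image under the identity.\<close>
  define \<nu>2 where "\<nu>2 = distr (density (M \<Otimes>\<^sub>M lborel) (case_prod ?g)) (F n \<Otimes>\<^sub>M borel) (\<lambda>p. p)"
  have \<nu>1: "integral\<^sup>N \<nu>1 h = (\<integral>\<^sup>+\<omega>. indicator ?E \<omega> * h (\<omega>, W n \<omega>) \<partial>M)"
    if [measurable]: "h \<in> borel_measurable (F n \<Otimes>\<^sub>M borel)" for h
    unfolding \<nu>1_def using pw measurable_compose[OF pw that]
    by (subst nn_integral_distr) (simp_all add: that nn_integral_density)
  have \<nu>2: "integral\<^sup>N \<nu>2 h = (\<integral>\<^sup>+\<omega>. \<integral>\<^sup>+w. ?g \<omega> w * h (\<omega>, w) \<partial>lborel \<partial>M)"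
    if h: "h \<in> borel_measurable (F n \<Otimes>\<^sub>M borel)" for h
  proof -
    note hM = history_time_measurable[OF h]
    have "integral\<^sup>N \<nu>2 h = (\<integral>\<^sup>+p. h p \<partial>density (M \<Otimes>\<^sub>M lborel) (case_prod ?g))"
      unfolding \<nu>2_def using identity_measurable_history_time by (subst nn_integral_distr) (simp_all add: h)
    also have "\<dots> = (\<integral>\<^sup>+p. case_prod ?g p * h p \<partial>(M \<Otimes>\<^sub>M lborel))"
      by (rule nn_integral_density[OF g hM])
    also have "\<dots> = (\<integral>\<^sup>+\<omega>. \<integral>\<^sup>+w. ?g \<omega> w * h (\<omega>, w) \<partial>lborel \<partial>M)"
      using lborel.nn_integral_fst[OF borel_measurable_times_ennreal[OF g hM]] by simp
    finally show ?thesis .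
  qed
  have sets_\<nu>: "sets \<nu>1 = sets (F n \<Otimes>\<^sub>M borel)" "sets \<nu>2 = sets (F n \<Otimes>\<^sub>M borel)"
    unfolding \<nu>1_def \<nu>2_def by (simp_all only: sets_distr)
  have "\<nu>1 = \<nu>2"
  proof (rule measure_eqI_generator_eq[OF Int_stable_pair_measure_generator[of "F n" borel],
        where A = "\<lambda>_. space M \<times> UNIV"])
    show "{a \<times> b |a b. a \<in> sets (F n) \<and> b \<in> sets borel} \<subseteq> Pow (space M \<times> (UNIV :: real set))"
      using sets.sets_into_space[of _ "F n"] by auto
    show "sets \<nu>1 = sigma_sets (space M \<times> UNIV) {a \<times> b |a b. a \<in> sets (F n) \<and> b \<in> sets (borel :: real measure)}"
      "sets \<nu>2 = sigma_sets (space M \<times> UNIV) {a \<times> b |a b. a \<in> sets (F n) \<and> b \<in> sets (borel :: real measure)}"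
      unfolding sets_\<nu> by (simp_all add: sets_pair_measure)
    show "range (\<lambda>_::nat. space M \<times> UNIV) \<subseteq> {a \<times> b |a b. a \<in> sets (F n) \<and> b \<in> sets (borel :: real measure)}"
      using sets.top[of "F n"] by (auto intro!: exI[of _ "space M"] exI[of _ "UNIV :: real set"])
    show "emeasure \<nu>1 (space M \<times> UNIV) \<noteq> \<infinity>"
    proof -
      have "space M \<times> (UNIV :: real set) \<in> sets (F n \<Otimes>\<^sub>M borel)"
        using sets.top[of "F n"] by (intro pair_measureI) auto
      then have "emeasure \<nu>1 (space M \<times> UNIV) = (\<integral>\<^sup>+\<omega>. indicator ?E \<omega> * indicator (space M \<times> UNIV) (\<omega>, W n \<omega>) \<partial>M)"
        by (subst nn_integral_indicator[symmetric], simp add: sets_\<nu>, subst \<nu>1) simp_all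
      also have "\<dots> \<le> (\<integral>\<^sup>+\<omega>. 1 \<partial>M)"
        by (intro nn_integral_mono) (simp add: indicator_def)
      finally show ?thesis by (auto simp: walk.emeasure_space_1 top_unique)
    qed
    fix Y :: "('a \<times> real) set" assume "Y \<in> {a \<times> b |a b. a \<in> sets (F n) \<and> b \<in> sets borel}"
    then obtain H B where Y: "Y = H \<times> B" and H: "H \<in> sets (F n)" and B: "B \<in> sets borel" by auto
    have YF: "Y \<in> sets (F n \<Otimes>\<^sub>M borel)" unfolding Y using H B by (rule pair_measureI)
    have Hs: "H \<subseteq> space M" using sets.sets_into_space[OF H] by simp
    have "emeasure \<nu>1 Y = (\<integral>\<^sup>+\<omega>. indicator ?E \<omega> * indicator Y (\<omega>, W n \<omega>) \<partial>M)"
      using YF by (subst nn_integral_indicator[symmetric], simp add: sets_\<nu>, subst \<nu>1) simp_all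
    also have "\<dots> = (\<integral>\<^sup>+\<omega>. indicator {\<omega>\<in>H. W n \<omega> \<in> B \<and> J n \<omega> = i \<and> R n \<omega> \<in> D} \<omega> \<partial>M)"
      using Hs by (intro nn_integral_cong) (auto simp: Y indicator_def)
    also have "\<dots> = emeasure M {\<omega>\<in>H. W n \<omega> \<in> B \<and> J n \<omega> = i \<and> R n \<omega> \<in> D}"
    proof (rule nn_integral_indicator)
      have "H \<in> sets M" using H history_subalgebra[of n] by (auto simp: subalgebra_def)
      moreover have "{\<omega>\<in>H. W n \<omega> \<in> B \<and> J n \<omega> = i \<and> R n \<omega> \<in> D} = H \<inter> {\<omega>\<in>space M. W n \<omega> \<in> B \<and> J n \<omega> = i \<and> R n \<omega> \<in> D}"
        using Hs by auto
      ultimately show "{\<omega>\<in>H. W n \<omega> \<in> B \<and> J n \<omega> = i \<and> R n \<omega> \<in> D} \<in> sets M"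
        using B by simp
    qed
    also have "\<dots> = (\<integral>\<^sup>+\<omega>. \<integral>\<^sup>+w. ?g \<omega> w * indicator Y (\<omega>, w) \<partial>lborel \<partial>M)"
      unfolding waiting_time_law_on_history[OF D H B] Y by (simp add: mult_ac)
    also have "\<dots> = emeasure \<nu>2 Y"
      using YF by (subst nn_integral_indicator[symmetric], simp add: sets_\<nu>, subst \<nu>2) simp_all
    finally show "emeasure \<nu>1 Y = emeasure \<nu>2 Y" .
  qed simp
  have "(\<integral>\<^sup>+\<omega>. f (\<omega>, W n \<omega>) * indicator {\<omega>. J n \<omega> = i \<and> R n \<omega> \<in> D} \<omega> \<partial>M) = integral\<^sup>N \<nu>1 f"
    unfolding \<nu>1[OF f] by (intro nn_integral_cong) (simp add: indicator_def)
  also have "\<dots> = (\<integral>\<^sup>+\<omega>. \<integral>\<^sup>+w. ?g \<omega> w * f (\<omega>, w) \<partial>lborel \<partial>M)"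
    unfolding \<open>\<nu>1 = \<nu>2\<close> \<nu>2[OF f] ..
  also have "\<dots> = (\<integral>\<^sup>+\<omega>. (ennreal (type_prob n i \<omega>) *
          (\<integral>\<^sup>+w. f (\<omega>, w) * ennreal (exponential_density (total (S n \<omega>)) w) \<partial>lborel)) * ?\<mu> \<partial>M)"
  proof (rule nn_integral_cong)
    fix \<omega> assume "\<omega> \<in> space M"
    then have [measurable]: "(\<lambda>w. f (\<omega>, w)) \<in> borel_measurable lborel"
      by (intro measurable_compose[OF _ fM]) simp
    have "(\<integral>\<^sup>+w. ?g \<omega> w * f (\<omega>, w) \<partial>lborel) = (\<integral>\<^sup>+w. (ennreal (type_prob n i \<omega>) * ?\<mu>) * 
        (f (\<omega>, w) * ennreal (exponential_density (total (S n \<omega>)) w)) \<partial>lborel)"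
      by (intro nn_integral_cong) (simp add: mult_ac)
    also have "\<dots> = (ennreal (type_prob n i \<omega>) * ?\<mu>) *
        (\<integral>\<^sup>+w. f (\<omega>, w) * ennreal (exponential_density (total (S n \<omega>)) w) \<partial>lborel)"
      by (intro nn_integral_cmult) measurable
    finally show "(\<integral>\<^sup>+w. ?g \<omega> w * f (\<omega>, w) \<partial>lborel) = (ennreal (type_prob n i \<omega>) *
          (\<integral>\<^sup>+w. f (\<omega>, w) * ennreal (exponential_density (total (S n \<omega>)) w) \<partial>lborel)) * ?\<mu>"
      by (simp add: mult_ac)
  qed
  also have "\<dots> = (\<integral>\<^sup>+\<omega>. ennreal (type_prob n i \<omega>) *
          (\<integral>\<^sup>+w. f (\<omega>, w) * ennreal (exponential_density (total (S n \<omega>)) w) \<partial>lborel) \<partial>M) * ?\<mu>"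
    unfolding exponential_density_def by (intro nn_integral_multc) measurable
  finally show ?thesis .
qed

text \<open>The complete description of one renewal: given the past, waiting time, type and row are drawn
  with the waiting time independent of the type and the row, and the row a fresh copy of the one that
  the type selects. As functions of the set of added vectors, both sides with
  \<open>h\<close> an indicator are measures, so the extension from indicators to \<open>h\<close> is the equality of two
  measures, whatever the total mass.\<close>
lemma renewal_integral:
  assumes f: "f \<in> borel_measurable (F n \<Otimes>\<^sub>M borel)" and h [measurable]: "h \<in> borel_measurable borel"
  shows "(\<integral>\<^sup>+\<omega>. f (\<omega>, W n \<omega>) * indicator {\<omega>. J n \<omega> = i} \<omega> * h (R n \<omega>) \<partial>M)
    = (\<integral>\<^sup>+\<omega>. ennreal (type_prob n i \<omega>) *
          (\<integral>\<^sup>+w. f (\<omega>, w) * ennreal (exponential_density (total (S n \<omega>)) w) \<partial>lborel) \<partial>M)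
      * (\<integral>\<^sup>+\<eta>. h (A \<eta> $ i) \<partial>N)"
    (is "_ = ?c * _")
proof -
  note [measurable] = history_time_measurable[OF f]
  let ?d = "\<lambda>\<omega>. f (\<omega>, W n \<omega>) * indicator {\<omega>\<in>space M. J n \<omega> = i} \<omega>"
  define \<kappa>1 where "\<kappa>1 = distr (density M ?d) borel (R n)"
  define \<kappa>2 where "\<kappa>2 = scale_measure ?c (distr N borel (\<lambda>\<eta>. A \<eta> $ i))"
  have [measurable]: "(\<lambda>\<omega>. f (\<omega>, W n \<omega>)) \<in> borel_measurable M" by measurable
  have "\<kappa>1 = \<kappa>2"
  proof (rule measure_eqI)
    fix D assume "D \<in> sets \<kappa>1"
    then have D [measurable]: "D \<in> sets borel" by (simp add: \<kappa>1_def)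
    have "emeasure \<kappa>1 D = (\<integral>\<^sup>+\<omega>. ?d \<omega> * indicator (R n -` D \<inter> space M) \<omega> \<partial>M)"
      unfolding \<kappa>1_def by (simp add: emeasure_distr emeasure_density)
    also have "\<dots> = (\<integral>\<^sup>+\<omega>. f (\<omega>, W n \<omega>) * indicator {\<omega>. J n \<omega> = i \<and> R n \<omega> \<in> D} \<omega> \<partial>M)"
      by (intro nn_integral_cong) (simp add: indicator_def)
    also have "\<dots> = ?c * emeasure N {\<eta>\<in>space N. A \<eta> $ i \<in> D}"
      by (rule waiting_time_integral[OF f D])
    also have "{\<eta>\<in>space N. A \<eta> $ i \<in> D} = (\<lambda>\<eta>. A \<eta> $ i) -` D \<inter> space N" by auto
    also have "?c * emeasure N \<dots> = emeasure \<kappa>2 D"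
      unfolding \<kappa>2_def by (simp add: emeasure_distr)
    finally show "emeasure \<kappa>1 D = emeasure \<kappa>2 D" .
  qed (simp add: \<kappa>1_def \<kappa>2_def)
  have "(\<integral>\<^sup>+\<omega>. f (\<omega>, W n \<omega>) * indicator {\<omega>. J n \<omega> = i} \<omega> * h (R n \<omega>) \<partial>M) = (\<integral>\<^sup>+\<omega>. ?d \<omega> * h (R n \<omega>) \<partial>M)"
    by (intro nn_integral_cong) (simp add: indicator_def)
  also have "\<dots> = integral\<^sup>N \<kappa>1 h"
    unfolding \<kappa>1_def by (simp add: nn_integral_distr nn_integral_density)
  also have "\<dots> = ?c * (\<integral>\<^sup>+\<eta>. h (A \<eta> $ i) \<partial>N)"
    unfolding \<open>\<kappa>1 = \<kappa>2\<close> \<kappa>2_def by (simp add: nn_integral_scale_measure nn_integral_distr)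
  finally show ?thesis .
qed

section \<open>Occupation densities and the flux of renewals\<close>

lemma time_Suc: "T (Suc n) \<omega> = T n \<omega> + W n \<omega>"
  by (simp add: renewal_time_def)

lemma time_0 [simp]: "T 0 \<omega> = 0"
  by (simp add: renewal_time_def)

lemma time_strict_mono: "AE \<omega> in M. strict_mono (\<lambda>n. T n \<omega>)"
  using waiting_time_pos by eventually_elim (simp add: strict_mono_Suc_iff time_Suc)

lemma time_nonneg: "AE \<omega> in M. \<forall>n. 0 \<le> T n \<omega>"
  using time_strict_mono
proof eventually_elim
  case (elim \<omega>)
  then show ?case using strict_mono_leD[OF elim, of 0] by auto
qed

lemma nn_integral_split_type:
  assumes [measurable]: "g \<in> borel_measurable M"
  shows "(\<integral>\<^sup>+\<omega>. g \<omega> \<partial>M) = (\<Sum>i\<in>UNIV. \<integral>\<^sup>+\<omega>. g \<omega> * indicator {\<omega>. J n \<omega> = i} \<omega> \<partial>M)"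
proof -
  have "(\<Sum>i\<in>UNIV. \<integral>\<^sup>+\<omega>. g \<omega> * indicator {\<omega>. J n \<omega> = i} \<omega> \<partial>M)
      = (\<Sum>i\<in>UNIV. \<integral>\<^sup>+\<omega>. g \<omega> * indicator {\<omega>\<in>space M. J n \<omega> = i} \<omega> \<partial>M)"
    by (intro sum.cong nn_integral_cong) (auto simp: indicator_def)
  also have "\<dots> = (\<integral>\<^sup>+\<omega>. (\<Sum>i\<in>UNIV. g \<omega> * indicator {\<omega>\<in>space M. J n \<omega> = i} \<omega>) \<partial>M)"
    by (intro nn_integral_sum[symmetric]) measurable
  also have "\<dots> = (\<integral>\<^sup>+\<omega>. g \<omega> \<partial>M)"
    by (intro nn_integral_cong) (simp add: indicator_def sum_distrib_left[symmetric])
  finally show ?thesis by simp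
qed

lemma waiting_time_integral_total:
  assumes f: "f \<in> borel_measurable (F n \<Otimes>\<^sub>M borel)"
  shows "(\<integral>\<^sup>+\<omega>. f (\<omega>, W n \<omega>) \<partial>M)
    = (\<integral>\<^sup>+\<omega>. \<integral>\<^sup>+w. f (\<omega>, w) * ennreal (exponential_density (total (S n \<omega>)) w) \<partial>lborel \<partial>M)"
proof -
  note [measurable] = history_time_measurable[OF f]
  let ?I = "\<lambda>\<omega>. \<integral>\<^sup>+w. f (\<omega>, w) * ennreal (exponential_density (total (S n \<omega>)) w) \<partial>lborel"
  have I [measurable]: "?I \<in> borel_measurable M"
    unfolding exponential_density_def by measurable
  have "(\<integral>\<^sup>+\<omega>. f (\<omega>, W n \<omega>) \<partial>M) = (\<Sum>i\<in>UNIV. \<integral>\<^sup>+\<omega>. f (\<omega>, W n \<omega>) * indicator {\<omega>. J n \<omega> = i} \<omega> \<partial>M)"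
    by (rule nn_integral_split_type) measurable
  also have "\<dots> = (\<Sum>i\<in>UNIV. \<integral>\<^sup>+\<omega>. ennreal (type_prob n i \<omega>) * ?I \<omega> \<partial>M)"
    using renewal_integral[OF f, of "\<lambda>_. 1"] by (simp add: nav.emeasure_space_1)
  also have "\<dots> = (\<integral>\<^sup>+\<omega>. (\<Sum>i\<in>UNIV. ennreal (type_prob n i \<omega>) * ?I \<omega>) \<partial>M)"
    by (intro nn_integral_sum[symmetric]) measurable
  also have "\<dots> = (\<integral>\<^sup>+\<omega>. ?I \<omega> \<partial>M)"
    using type_prob_distribution
    by (intro nn_integral_cong_AE)
      (auto elim!: eventually_mono simp: sum_distrib_right[symmetric])
  finally show ?thesis .
qed

text \<open>Since \<open>S k\<close> carries the rate of each type, this is at the same time the contribution of stretch \<open>k\<close> to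
  the mean of coordinate \<open>i\<close> and the intensity at time \<open>s\<close> of the event that renewal \<open>k\<close> occurs with
  type \<open>i\<close>.\<close>
definition occupation :: "nat \<Rightarrow> 'c \<Rightarrow> real \<Rightarrow> ennreal" where
  "occupation k i s = (\<integral>\<^sup>+\<omega>. ennreal (S k \<omega> $ i) * indicator {T k \<omega>..<T (Suc k) \<omega>} s \<partial>M)"

text \<open>The end of the stretch is integrated out: given the past, the stretch still lasts at time \<open>s\<close> with the
  probability that the exponential waiting time exceeds \<open>s - T k\<close>.\<close>
lemma occupation_eq:
  "occupation k i s = (\<integral>\<^sup>+\<omega>. ennreal (S k \<omega> $ i) *
      (indicator {T k \<omega>..} s * ennreal (exp (- total (S k \<omega>) * (s - T k \<omega>)))) \<partial>M)"
proof -
  let ?f = "\<lambda>(\<omega>, w). ennreal (S k \<omega> $ i) * (if T k \<omega> \<le> s then 1 else 0) * (if s < T k \<omega> + w then 1 else 0) :: ennreal"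
  have "occupation k i s = (\<integral>\<^sup>+\<omega>. ?f (\<omega>, W k \<omega>) \<partial>M)"
    unfolding occupation_def by (intro nn_integral_cong) (auto simp: time_Suc indicator_def)
  also have "\<dots> = (\<integral>\<^sup>+\<omega>. \<integral>\<^sup>+w. ?f (\<omega>, w) * ennreal (exponential_density (total (S k \<omega>)) w) \<partial>lborel \<partial>M)"
    by (rule waiting_time_integral_total) measurable
  also have "\<dots> = (\<integral>\<^sup>+\<omega>. ennreal (S k \<omega> $ i) *
      (indicator {T k \<omega>..} s * ennreal (exp (- total (S k \<omega>) * (s - T k \<omega>)))) \<partial>M)"
  proof (rule nn_integral_cong_AE)
    show "AE \<omega> in M. (\<integral>\<^sup>+w. ?f (\<omega>, w) * ennreal (exponential_density (total (S k \<omega>)) w) \<partial>lborel)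
      = ennreal (S k \<omega> $ i) * (indicator {T k \<omega>..} s * ennreal (exp (- total (S k \<omega>) * (s - T k \<omega>))))"
      using total_pos
    proof eventually_elim
      case (elim \<omega>)
      have "(\<integral>\<^sup>+w. ?f (\<omega>, w) * ennreal (exponential_density (total (S k \<omega>)) w) \<partial>lborel)
        = (\<integral>\<^sup>+w. (ennreal (S k \<omega> $ i) * indicator {T k \<omega>..} s) *
           (ennreal (exponential_density (total (S k \<omega>)) w) * indicator {s - T k \<omega><..} w) \<partial>lborel)"
        by (intro nn_integral_cong) (auto simp: indicator_def)
      also have "\<dots> = (ennreal (S k \<omega> $ i) * indicator {T k \<omega>..} s) * ennreal (exp (- total (S k \<omega>) * max 0 (s - T k \<omega>)))"
        using elim by (subst nn_integral_cmult) (auto simp: exponential_density_tail)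
      finally show ?case by (auto simp: indicator_def)
    qed
  qed
  finally show ?thesis .
qed

lemma occupation_measurable [measurable]: "occupation k i \<in> borel_measurable borel"
proof -
  have "(\<lambda>s. \<integral>\<^sup>+\<omega>. ennreal (S k \<omega> $ i) * (if T k \<omega> \<le> s \<and> s < T (Suc k) \<omega> then 1 else 0) \<partial>M) \<in> borel_measurable borel"
    by measurable
  also have "(\<lambda>s. \<integral>\<^sup>+\<omega>. ennreal (S k \<omega> $ i) * (if T k \<omega> \<le> s \<and> s < T (Suc k) \<omega> then 1 else 0) \<partial>M) = occupation k i"
    unfolding occupation_def by (intro ext nn_integral_cong) (auto simp: indicator_def)
  finally show ?thesis .
qed

text \<open>Given the past, renewal \<open>k\<close> of type \<open>i\<close> happens at time \<open>s\<close> with density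
  \<open>(S\<^sub>i k / total) * total * exp (- total * (s - T k))\<close>. The totals cancel, and what is left is the
  integrand of \<open>occupation_eq\<close>.\<close>
lemma renewal_flux:
  assumes h [measurable]: "h \<in> borel_measurable borel"
  shows "(\<integral>\<^sup>+\<omega>. indicator {..t} (T (Suc k) \<omega>) * indicator {\<omega>. J k \<omega> = i} \<omega> * h (R k \<omega>) \<partial>M)
    = (\<integral>\<^sup>+s\<in>{0..t}. occupation k i s \<partial>lborel) * (\<integral>\<^sup>+\<eta>. h (A \<eta> $ i) \<partial>N)"
proof -
  let ?f = "\<lambda>(\<omega>, w). indicator {..t} (T k \<omega> + w) :: ennreal"
  let ?g = "\<lambda>\<omega> s. ennreal (S k \<omega> $ i) *
      ((if T k \<omega> \<le> s then 1 else 0) * ennreal (exp (- total (S k \<omega>) * (s - T k \<omega>)))) * indicator {0..t} s"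
  have "(\<integral>\<^sup>+\<omega>. indicator {..t} (T (Suc k) \<omega>) * indicator {\<omega>. J k \<omega> = i} \<omega> * h (R k \<omega>) \<partial>M)
    = (\<integral>\<^sup>+\<omega>. ennreal (type_prob k i \<omega>) *
          (\<integral>\<^sup>+w. ?f (\<omega>, w) * ennreal (exponential_density (total (S k \<omega>)) w) \<partial>lborel) \<partial>M)
      * (\<integral>\<^sup>+\<eta>. h (A \<eta> $ i) \<partial>N)"
    using renewal_integral[of ?f k h i] by (simp add: time_Suc)
  also have "(\<integral>\<^sup>+\<omega>. ennreal (type_prob k i \<omega>) *
          (\<integral>\<^sup>+w. ?f (\<omega>, w) * ennreal (exponential_density (total (S k \<omega>)) w) \<partial>lborel) \<partial>M)
      = (\<integral>\<^sup>+\<omega>. \<integral>\<^sup>+s. ?g \<omega> s \<partial>lborel \<partial>M)"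
  proof (rule nn_integral_cong_AE)
    show "AE \<omega> in M. ennreal (type_prob k i \<omega>) *
          (\<integral>\<^sup>+w. ?f (\<omega>, w) * ennreal (exponential_density (total (S k \<omega>)) w) \<partial>lborel)
      = (\<integral>\<^sup>+s. ?g \<omega> s \<partial>lborel)"
      using total_pos time_nonneg type_prob_distribution
    proof eventually_elim
      case (elim \<omega>)
      let ?l = "total (S k \<omega>)"
      have pos: "0 < ?l" "0 \<le> T k \<omega>" "0 \<le> type_prob k i \<omega>" using elim by auto
      then have *: "type_prob k i \<omega> * ?l = S k \<omega> $ i" by (simp add: type_prob_def)
      have [measurable]: "exponential_density ?l \<in> borel_measurable borel" by simp
      \<comment> \<open>Substitute the renewal time \<open>s = T k + w\<close> for the waiting time \<open>w\<close>.\<close>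
      have "(\<integral>\<^sup>+w. ?f (\<omega>, w) * ennreal (exponential_density ?l w) \<partial>lborel)
        = (\<integral>\<^sup>+s. indicator {..t} s * ennreal (exponential_density ?l (s - T k \<omega>)) \<partial>lborel)"
        by (subst nn_integral_real_affine[where c = 1 and t = "- T k \<omega>"]) simp_all
      then have "ennreal (type_prob k i \<omega>) * (\<integral>\<^sup>+w. ?f (\<omega>, w) * ennreal (exponential_density ?l w) \<partial>lborel)
        = (\<integral>\<^sup>+s. ennreal (type_prob k i \<omega>) * (indicator {..t} s * ennreal (exponential_density ?l (s - T k \<omega>))) \<partial>lborel)"
        by (simp add: nn_integral_cmult)
      also have "\<dots> = (\<integral>\<^sup>+s. ?g \<omega> s \<partial>lborel)"
      proof (rule nn_integral_cong)
        fix s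
        have "ennreal (type_prob k i \<omega>) * ennreal (?l * exp (- (s - T k \<omega>) * ?l))
            = ennreal (S k \<omega> $ i) * ennreal (exp (- ?l * (s - T k \<omega>)))"
          using pos by (simp add: ennreal_mult''[symmetric] *[symmetric] algebra_simps)
        then show "ennreal (type_prob k i \<omega>) * (indicator {..t} s * ennreal (exponential_density ?l (s - T k \<omega>))) = ?g \<omega> s"
          using pos by (auto simp: exponential_density_def indicator_def)
      qed
      finally show ?case .
    qed
  qed
  also have "\<dots> = (\<integral>\<^sup>+s. \<integral>\<^sup>+\<omega>. ?g \<omega> s \<partial>M \<partial>lborel)"
  proof -
    interpret pair_sigma_finite M lborel
      by (simp add: pair_sigma_finite_def walk.sigma_finite_measure_axioms lborel.sigma_finite_measure_axioms)
    show ?thesis by (rule Fubini'[symmetric]) measurable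
  qed
  also have "\<dots> = (\<integral>\<^sup>+s\<in>{0..t}. occupation k i s \<partial>lborel)"
    unfolding occupation_eq
    by (intro nn_integral_cong, subst nn_integral_multc[symmetric])
      (auto intro!: nn_integral_cong simp: indicator_def)
  finally show ?thesis .
qed

end

section \<open>Non-explosion and the equation for the mean\<close>

text \<open>Exponential moments in the directions \<open>\<plusminus> e\<close> of a coordinate axis bound the first absolute moment,
  since \<open>e \<bar>a\<bar> \<le> exp (e a) + exp (- e a)\<close>.\<close>
lemma integrable_entry_if_mgf_finite:
  fixes A :: "'b \<Rightarrow> real^'c^'c"
  assumes A [measurable]: "A \<in> borel_measurable N" and mgf: "row_mgfs_finite_near_0 N A"
  shows "integrable N (\<lambda>\<eta>. A \<eta> $ i $ j)"
proof -
  obtain d where d: "0 < d" "\<And>u. dist u 0 < d \<Longrightarrow> row_mgf N A i u < \<infinity>"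
    using mgf by (auto simp: row_mgfs_finite_near_0_def eventually_nhds_metric)
  define e where "e = d / 2"
  have e: "0 < e" using d by (simp add: e_def)
  have fin: "(\<integral>\<^sup>+\<eta>. ennreal (exp (c * A \<eta> $ i $ j)) \<partial>N) < \<infinity>" if "\<bar>c\<bar> = e" for c
  proof -
    have "(\<Sum>k\<in>UNIV. (c *\<^sub>R axis j 1 :: real^'c) $ k * A \<eta> $ i $ k) = c * A \<eta> $ i $ j" for \<eta>
      by (simp add: axis_def if_distrib if_distribR cong: if_cong)
    moreover have "dist (c *\<^sub>R axis j 1 :: real^'c) 0 < d"
      using that d by (simp add: e_def)
    ultimately show ?thesis using d(2)[of "c *\<^sub>R axis j 1"] by (simp add: row_mgf_def)
  qed
  have "(\<integral>\<^sup>+\<eta>. ennreal (norm (A \<eta> $ i $ j)) \<partial>N)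
      \<le> (\<integral>\<^sup>+\<eta>. ennreal (1 / e) * (ennreal (exp (e * A \<eta> $ i $ j)) + ennreal (exp ((- e) * A \<eta> $ i $ j))) \<partial>N)"
  proof (rule nn_integral_mono)
    fix \<eta>
    let ?a = "A \<eta> $ i $ j"
    have "e * \<bar>?a\<bar> \<le> exp (e * ?a) + exp ((- e) * ?a)"
    proof -
      have "e * \<bar>?a\<bar> = \<bar>e * ?a\<bar>" using e by (simp add: abs_mult)
      moreover have "1 + e * ?a \<le> exp (e * ?a)" "1 - e * ?a \<le> exp ((- e) * ?a)"
        using exp_ge_add_one_self[of "e * ?a"] exp_ge_add_one_self[of "- e * ?a"] by simp_all
      moreover have "0 \<le> exp (e * ?a)" "0 \<le> exp ((- e) * ?a)" by simp_all
      ultimately show ?thesis by linarith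
    qed
    then have "\<bar>?a\<bar> \<le> 1 / e * (exp (e * ?a) + exp ((- e) * ?a))"
      using e by (simp add: field_simps)
    then have "ennreal \<bar>?a\<bar> \<le> ennreal (1 / e * (exp (e * ?a) + exp ((- e) * ?a)))" by (rule ennreal_leI)
    also have "\<dots> = ennreal (1 / e) * (ennreal (exp (e * ?a)) + ennreal (exp ((- e) * ?a)))"
      using e by (subst ennreal_mult) auto
    finally show "ennreal (norm ?a) \<le> ennreal (1 / e) * (ennreal (exp (e * ?a)) + ennreal (exp ((- e) * ?a)))" by simp
  qed
  also have "\<dots> = ennreal (1 / e) * ((\<integral>\<^sup>+\<eta>. ennreal (exp (e * A \<eta> $ i $ j)) \<partial>N) + (\<integral>\<^sup>+\<eta>. ennreal (exp ((- e) * A \<eta> $ i $ j)) \<partial>N))"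
    by (subst nn_integral_cmult) (auto simp: nn_integral_add)
  also have "\<dots> < \<infinity>"
    using fin[of e] fin[of "- e"] e by (simp add: ennreal_mult_less_top)
  finally show ?thesis by (intro integrableI_bounded) measurable
qed

definition l1_norm :: "real^'c \<Rightarrow> real" where "l1_norm x = (\<Sum>j\<in>UNIV. \<bar>x $ j\<bar>)"

lemma measurable_l1_norm [measurable (raw)]:
  "f \<in> borel_measurable M \<Longrightarrow> (\<lambda>x. l1_norm (f x)) \<in> borel_measurable M"
  unfolding l1_norm_def by measurable

lemma l1_norm_nonneg [simp]: "0 \<le> l1_norm x"
  unfolding l1_norm_def by (simp add: sum_nonneg)

locale integrable_polya_walk = tenable_polya_walk M N A x0 F W J R X
  for M :: "'a measure" and N :: "'b measure" and A :: "'b \<Rightarrow> real^'c^'c" and x0 :: "real^'c"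
    and F :: "nat \<Rightarrow> 'a measure" and W :: "nat \<Rightarrow> 'a \<Rightarrow> real" and J :: "nat \<Rightarrow> 'a \<Rightarrow> 'c"
    and R :: "nat \<Rightarrow> 'a \<Rightarrow> real^'c" and X :: "real \<Rightarrow> 'a \<Rightarrow> real^'c" +
  assumes rows_integrable: "\<And>i j. integrable N (\<lambda>\<eta>. A \<eta> $ i $ j)"
begin

text \<open>The sum over \<open>i\<close> is a convenient upper bound for the largest expected jump, and the added \<open>1\<close> makes it
  positive, as the Gronwall inequality requires.\<close>
definition jump_bound :: real where
  "jump_bound = 1 + (\<Sum>i\<in>UNIV. \<integral>\<eta>. l1_norm (A \<eta> $ i) \<partial>N)"

lemma jump_bound_pos: "0 < jump_bound"
  unfolding jump_bound_def by (intro add_pos_nonneg sum_nonneg) auto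

lemma expected_jump_le: "(\<integral>\<^sup>+\<eta>. ennreal (l1_norm (A \<eta> $ i)) \<partial>N) \<le> ennreal jump_bound"
proof -
  have int: "integrable N (\<lambda>\<eta>. l1_norm (A \<eta> $ i))" for i
    unfolding l1_norm_def using rows_integrable by (intro Bochner_Integration.integrable_sum integrable_abs)
  have "(\<integral>\<eta>. l1_norm (A \<eta> $ i) \<partial>N) \<le> (\<Sum>i\<in>UNIV. \<integral>\<eta>. l1_norm (A \<eta> $ i) \<partial>N)"
    by (intro member_le_sum) auto
  then show ?thesis
    using int by (subst nn_integral_eq_integral) (auto simp: jump_bound_def intro!: ennreal_leI)
qed

lemma start_nonneg: "0 \<le> x0 $ j"
proof -
  have "AE \<omega> in M. 0 \<le> x0 $ j"
    using state_nonneg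
  proof eventually_elim
    case (elim \<omega>)
    then have "0 \<le> S 0 \<omega> $ j" by blast
    then show ?case by (simp add: renewal_state_def)
  qed
  then show ?thesis by simp
qed

lemma total_start_nonneg: "0 \<le> total x0"
  unfolding total_def by (intro sum_nonneg start_nonneg)

text \<open>This and the next lemma are the combinatorics of a point \<open>t\<close> in the \<open>k\<close>-th stretch: no other stretch
  contains it, and exactly the renewals before number \<open>k\<close> have happened.\<close>
lemma stretch_unique:
  assumes "strict_mono (\<lambda>n. T n \<omega>)" "T k \<omega> \<le> t" "t < T (Suc k) \<omega>" "T l \<omega> \<le> t" "t < T (Suc l) \<omega>"
  shows "l = k"
proof -
  have "T l \<omega> < T (Suc k) \<omega>" "T k \<omega> < T (Suc l) \<omega>" using assms by auto
  then have "l < Suc k" "k < Suc l" using strict_mono_less[OF assms(1)] by blast+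
  then show ?thesis by simp
qed

lemma stretch_time_le:
  assumes "strict_mono (\<lambda>n. T n \<omega>)" "T k \<omega> \<le> t" "t < T (Suc k) \<omega>"
  shows "T (Suc l) \<omega> \<le> t \<longleftrightarrow> l < k"
proof
  assume "T (Suc l) \<omega> \<le> t"
  then have "T (Suc l) \<omega> < T (Suc k) \<omega>" using assms by simp
  then show "l < k" using strict_mono_less[OF assms(1)] by (metis Suc_less_eq)
next
  assume "l < k"
  then have "T (Suc l) \<omega> \<le> T k \<omega>" using strict_mono_less_eq[OF assms(1)] by (metis Suc_leI)
  then show "T (Suc l) \<omega> \<le> t" using assms by simp
qed

text \<open>At most one stretch contains \<open>t\<close>, and on it the total position is the initial total plus the
  jumps so far; nonnegativity lets the coordinates be added up inside \<open>ennreal\<close>. Replacing the jumps by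
  their norms turns the right-hand side into the kind of sum that \<open>renewal_flux\<close> evaluates.\<close>
lemma occupation_le_start_plus_jumps:
  "AE \<omega> in M. (\<Sum>k<n. \<Sum>i\<in>UNIV. ennreal (S k \<omega> $ i) * indicator {T k \<omega>..<T (Suc k) \<omega>} t)
    \<le> ennreal (total x0) + (\<Sum>k<n. indicator {..t} (T (Suc k) \<omega>) * ennreal (l1_norm (R k \<omega>)))"
  using time_strict_mono state_nonneg
proof eventually_elim
  case (elim \<omega>)
  show ?case
  proof (cases "\<exists>k<n. T k \<omega> \<le> t \<and> t < T (Suc k) \<omega>")
    case True
    then obtain k where k: "k < n" "T k \<omega> \<le> t" "t < T (Suc k) \<omega>" by auto
    have "(\<Sum>m<n. \<Sum>i\<in>UNIV. ennreal (S m \<omega> $ i) * indicator {T m \<omega>..<T (Suc m) \<omega>} t)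
      = (\<Sum>m\<in>{k}. \<Sum>i\<in>UNIV. ennreal (S m \<omega> $ i) * indicator {T m \<omega>..<T (Suc m) \<omega>} t)"
      using k
      by (intro sum.mono_neutral_right) (auto simp: indicator_def dest: stretch_unique[OF elim(1) k(2,3)])
    also have "\<dots> = ennreal (total (S k \<omega>))"
      using k elim by (simp add: total_def sum_ennreal)
    also have "total (S k \<omega>) = total x0 + (\<Sum>l<k. total (R l \<omega>))"
      by (simp add: total_def renewal_state_def sum.distrib sum_component) (rule sum.swap)
    also have "\<dots> \<le> total x0 + (\<Sum>l<k. l1_norm (R l \<omega>))"
      unfolding total_def l1_norm_def by (intro add_left_mono sum_mono) auto
    finally have "(\<Sum>m<n. \<Sum>i\<in>UNIV. ennreal (S m \<omega> $ i) * indicator {T m \<omega>..<T (Suc m) \<omega>} t)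
      \<le> ennreal (total x0 + (\<Sum>l<k. l1_norm (R l \<omega>)))"
      by (simp add: ennreal_leI)
    also have "\<dots> = ennreal (total x0) + (\<Sum>l<k. ennreal (l1_norm (R l \<omega>)))"
      using total_start_nonneg by (simp add: ennreal_plus sum_nonneg sum_ennreal)
    also have "(\<Sum>l<k. ennreal (l1_norm (R l \<omega>))) = (\<Sum>l<k. indicator {..t} (T (Suc l) \<omega>) * ennreal (l1_norm (R l \<omega>)))"
      using stretch_time_le[OF elim(1) k(2,3)] by (intro sum.cong) auto
    also have "\<dots> \<le> (\<Sum>l<n. indicator {..t} (T (Suc l) \<omega>) * ennreal (l1_norm (R l \<omega>)))"
      using k by (intro sum_mono2) auto
    finally show ?thesis by (simp add: add_left_mono)
  next
    case False
    then have "(\<Sum>k<n. \<Sum>i\<in>UNIV. ennreal (S k \<omega> $ i) * indicator {T k \<omega>..<T (Suc k) \<omega>} t) = 0"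
      by (intro sum.neutral) (auto simp: indicator_def)
    then show ?thesis by simp
  qed
qed

lemma renewal_flux_total:
  assumes h [measurable]: "h \<in> borel_measurable borel"
  shows "(\<integral>\<^sup>+\<omega>. indicator {..t} (T (Suc k) \<omega>) * h (R k \<omega>) \<partial>M)
    = (\<Sum>i\<in>UNIV. (\<integral>\<^sup>+s\<in>{0..t}. occupation k i s \<partial>lborel) * (\<integral>\<^sup>+\<eta>. h (A \<eta> $ i) \<partial>N))"
proof -
  have "(\<integral>\<^sup>+\<omega>. indicator {..t} (T (Suc k) \<omega>) * h (R k \<omega>) \<partial>M)
      = (\<Sum>i\<in>UNIV. \<integral>\<^sup>+\<omega>. indicator {..t} (T (Suc k) \<omega>) * h (R k \<omega>) * indicator {\<omega>. J k \<omega> = i} \<omega> \<partial>M)"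
    by (rule nn_integral_split_type) measurable
  also have "\<dots> = (\<Sum>i\<in>UNIV. \<integral>\<^sup>+\<omega>. indicator {..t} (T (Suc k) \<omega>) * indicator {\<omega>. J k \<omega> = i} \<omega> * h (R k \<omega>) \<partial>M)"
    by (intro sum.cong nn_integral_cong) (simp_all add: mult_ac)
  finally show ?thesis using renewal_flux[OF h] by simp
qed

lemma integral_truncated_occupation:
  "(\<integral>\<^sup>+s\<in>{0..t}. (\<Sum>k<n. \<Sum>i\<in>UNIV. occupation k i s) \<partial>lborel)
    = (\<Sum>k<n. \<Sum>i\<in>UNIV. \<integral>\<^sup>+s\<in>{0..t}. occupation k i s \<partial>lborel)"
  unfolding sum_distrib_right
  by (intro trans[OF nn_integral_sum] sum.cong refl nn_integral_sum) measurable

text \<open>The truncation at \<open>n\<close> renewals makes the left-hand side finite beforehand (see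
  \<open>truncated_occupation_bounded\<close>), while the constants are the same for every \<open>n\<close>.\<close>
lemma truncated_occupation_integral_inequality:
  "(\<Sum>k<n. \<Sum>i\<in>UNIV. occupation k i t)
    \<le> ennreal (total x0) + ennreal jump_bound * (\<integral>\<^sup>+s\<in>{0..t}. (\<Sum>k<n. \<Sum>i\<in>UNIV. occupation k i s) \<partial>lborel)"
    (is "?L \<le> _ + _ * ?I")
proof -
  have [measurable]: "(\<lambda>\<omega>. indicator {T k \<omega>..<T (Suc k) \<omega>} t :: ennreal) \<in> borel_measurable M" for k
    unfolding indicator_def by simp
  have "?L = (\<integral>\<^sup>+\<omega>. (\<Sum>k<n. \<Sum>i\<in>UNIV. ennreal (S k \<omega> $ i) * indicator {T k \<omega>..<T (Suc k) \<omega>} t) \<partial>M)"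
    unfolding occupation_def
    by (rule sym, intro trans[OF nn_integral_sum] sum.cong refl nn_integral_sum) measurable
  also have "\<dots> \<le> (\<integral>\<^sup>+\<omega>. ennreal (total x0) + (\<Sum>k<n. indicator {..t} (T (Suc k) \<omega>) * ennreal (l1_norm (R k \<omega>))) \<partial>M)"
    by (rule nn_integral_mono_AE[OF occupation_le_start_plus_jumps])
  also have "\<dots> = ennreal (total x0) + (\<Sum>k<n. \<integral>\<^sup>+\<omega>. indicator {..t} (T (Suc k) \<omega>) * ennreal (l1_norm (R k \<omega>)) \<partial>M)"
  proof -
    have "(\<integral>\<^sup>+\<omega>. (\<Sum>k<n. indicator {..t} (T (Suc k) \<omega>) * ennreal (l1_norm (R k \<omega>))) \<partial>M)
        = (\<Sum>k<n. \<integral>\<^sup>+\<omega>. indicator {..t} (T (Suc k) \<omega>) * ennreal (l1_norm (R k \<omega>)) \<partial>M)"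
      by (rule nn_integral_sum) measurable
    then show ?thesis
      by (subst nn_integral_add) (measurable, simp only: nn_integral_const walk.emeasure_space_1 mult_1_right)
  qed
  also have "\<dots> = ennreal (total x0) + (\<Sum>k<n. \<Sum>i\<in>UNIV. (\<integral>\<^sup>+s\<in>{0..t}. occupation k i s \<partial>lborel) * (\<integral>\<^sup>+\<eta>. ennreal (l1_norm (A \<eta> $ i)) \<partial>N))"
    by (subst renewal_flux_total[where h = "\<lambda>x. ennreal (l1_norm x)"]) simp_all
  also have "\<dots> \<le> ennreal (total x0) + (\<Sum>k<n. \<Sum>i\<in>UNIV. (\<integral>\<^sup>+s\<in>{0..t}. occupation k i s \<partial>lborel) * ennreal jump_bound)"
    by (intro add_left_mono sum_mono mult_left_mono expected_jump_le) simp
  also have "(\<Sum>k<n. \<Sum>i\<in>UNIV. (\<integral>\<^sup>+s\<in>{0..t}. occupation k i s \<partial>lborel) * ennreal jump_bound) = ennreal jump_bound * ?I"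
    unfolding integral_truncated_occupation by (simp add: sum_distrib_left mult.commute)
  finally show ?thesis .
qed

text \<open>The integral of the occupations of stretch \<open>k\<close> up to \<open>t\<close> is the probability that renewal \<open>k\<close> has happened
  by then, hence at most one. The bound grows with \<open>n\<close>, but \<open>gronwall_ennreal\<close> only asks it to be finite.\<close>
lemma truncated_occupation_bounded:
  "(\<Sum>k<n. \<Sum>i\<in>UNIV. occupation k i t) \<le> ennreal (total x0 + jump_bound * n)"
proof -
  have "(\<integral>\<^sup>+s\<in>{0..t}. (\<Sum>k<n. \<Sum>i\<in>UNIV. occupation k i s) \<partial>lborel)
      = (\<Sum>k<n. \<Sum>i\<in>UNIV. \<integral>\<^sup>+s\<in>{0..t}. occupation k i s \<partial>lborel)"
    by (rule integral_truncated_occupation)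
  also have "\<dots> = (\<Sum>k<n. \<integral>\<^sup>+\<omega>. indicator {..t} (T (Suc k) \<omega>) \<partial>M)"
    using renewal_flux_total[of "\<lambda>_. 1" t] by (simp add: nav.emeasure_space_1)
  also have "\<dots> \<le> (\<Sum>k<n. \<integral>\<^sup>+\<omega>. 1 \<partial>M)"
    by (intro sum_mono nn_integral_mono) (simp add: indicator_def)
  also have "\<dots> = ennreal n" by (simp add: walk.emeasure_space_1 ennreal_of_nat_eq_real_of_nat)
  finally have "ennreal (total x0) + ennreal jump_bound * (\<integral>\<^sup>+s\<in>{0..t}. (\<Sum>k<n. \<Sum>i\<in>UNIV. occupation k i s) \<partial>lborel)
      \<le> ennreal (total x0) + ennreal jump_bound * ennreal n"
    by (intro add_left_mono mult_left_mono) auto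
  also have "\<dots> = ennreal (total x0 + jump_bound * n)"
    using total_start_nonneg jump_bound_pos by (simp add: ennreal_plus ennreal_mult)
  finally show ?thesis using truncated_occupation_integral_inequality order_trans by blast
qed

text \<open>Before non-explosion is known, this is the mean of coordinate \<open>i\<close> on the event that time \<open>t\<close> comes before
  the explosion; \<open>expected_position\<close> identifies it with the mean of \<open>X t\<close>.\<close>
definition mean_coord :: "'c \<Rightarrow> real \<Rightarrow> ennreal" where
  "mean_coord i t = (\<Sum>k. occupation k i t)"

lemma mean_measurable [measurable]: "mean_coord i \<in> borel_measurable borel"
  unfolding mean_coord_def by measurable

lemma mean_le:
  assumes "0 \<le> t"
  shows "mean_coord i t \<le> ennreal (2 * total x0 * exp (2 * jump_bound * t))"
  unfolding mean_coord_def
proof (rule suminf_le_const)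
  fix n
  have "(\<Sum>k<n. occupation k i t) \<le> (\<Sum>k<n. \<Sum>i\<in>UNIV. occupation k i t)"
    by (intro sum_mono member_le_sum) auto
  also have "\<dots> \<le> ennreal (2 * total x0 * exp (2 * jump_bound * t))"
    by (rule gronwall_ennreal[where g = "\<lambda>t. \<Sum>k<n. \<Sum>i\<in>UNIV. occupation k i t",
          OF _ truncated_occupation_integral_inequality truncated_occupation_bounded
            jump_bound_pos total_start_nonneg assms]) measurable
  finally show "(\<Sum>k<n. occupation k i t) \<le> ennreal (2 * total x0 * exp (2 * jump_bound * t))" .
qed simp

lemma mean_le_on_interval:
  assumes "0 \<le> s" "s \<le> t"
  shows "mean_coord i s \<le> ennreal (2 * total x0 * exp (2 * jump_bound * t))"
proof -
  have "2 * total x0 * exp (2 * jump_bound * s) \<le> 2 * total x0 * exp (2 * jump_bound * t)"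
    using assms total_start_nonneg jump_bound_pos by (intro mult_left_mono) auto
  then show ?thesis using mean_le[OF assms(1)] by (meson ennreal_leI order_trans)
qed

lemma integral_mean_finite: "(\<integral>\<^sup>+s\<in>{0..t}. mean_coord i s \<partial>lborel) < \<infinity>"
proof -
  have "(\<integral>\<^sup>+s\<in>{0..t}. mean_coord i s \<partial>lborel)
      \<le> (\<integral>\<^sup>+s\<in>{0..t}. ennreal (2 * total x0 * exp (2 * jump_bound * t)) \<partial>lborel)"
    using mean_le_on_interval by (intro nn_integral_mono) (auto simp: indicator_def)
  also have "\<dots> < \<infinity>"
    by (cases "0 \<le> t") (auto simp: nn_integral_cmult_indicator ennreal_mult_less_top)
  finally show ?thesis .
qed

lemma expected_jump_sum:
  assumes h [measurable]: "h \<in> borel_measurable borel"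
  shows "(\<integral>\<^sup>+\<omega>. (\<Sum>k. indicator {..t} (T (Suc k) \<omega>) * h (R k \<omega>)) \<partial>M)
    = (\<Sum>i\<in>UNIV. (\<integral>\<^sup>+s\<in>{0..t}. mean_coord i s \<partial>lborel) * (\<integral>\<^sup>+\<eta>. h (A \<eta> $ i) \<partial>N))"
proof -
  have "(\<integral>\<^sup>+\<omega>. (\<Sum>k. indicator {..t} (T (Suc k) \<omega>) * h (R k \<omega>)) \<partial>M)
      = (\<Sum>k. \<integral>\<^sup>+\<omega>. indicator {..t} (T (Suc k) \<omega>) * h (R k \<omega>) \<partial>M)"
    by (intro nn_integral_suminf) measurable
  also have "\<dots> = (\<Sum>k. \<Sum>i\<in>UNIV. (\<integral>\<^sup>+s\<in>{0..t}. occupation k i s \<partial>lborel) * (\<integral>\<^sup>+\<eta>. h (A \<eta> $ i) \<partial>N))"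
    unfolding renewal_flux_total[OF h] ..
  also have "\<dots> = (\<Sum>i\<in>UNIV. \<Sum>k. (\<integral>\<^sup>+s\<in>{0..t}. occupation k i s \<partial>lborel) * (\<integral>\<^sup>+\<eta>. h (A \<eta> $ i) \<partial>N))"
    by (intro suminf_sum) simp
  also have "\<dots> = (\<Sum>i\<in>UNIV. (\<Sum>k. \<integral>\<^sup>+s\<in>{0..t}. occupation k i s \<partial>lborel) * (\<integral>\<^sup>+\<eta>. h (A \<eta> $ i) \<partial>N))"
    by simp
  also have "(\<lambda>i. \<Sum>k. \<integral>\<^sup>+s\<in>{0..t}. occupation k i s \<partial>lborel) = (\<lambda>i. \<integral>\<^sup>+s\<in>{0..t}. mean_coord i s \<partial>lborel)"
    unfolding mean_coord_def by (intro ext, subst nn_integral_suminf[symmetric]) simp_all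
  finally show ?thesis by meson
qed

text \<open>The expected number of renewals up to time \<open>t\<close> is \<open>\<Sum>\<^sub>i \<integral>\<^sub>0\<^sup>t mean_coord i s ds\<close>, which is finite; so almost
  surely some renewal comes after \<open>t\<close>, and the first such one ends the stretch that contains \<open>t\<close>.\<close>
lemma no_explosion:
  assumes "0 \<le> t"
  shows "AE \<omega> in M. \<exists>k. T k \<omega> \<le> t \<and> t < T (Suc k) \<omega>"
proof -
  have "(\<integral>\<^sup>+\<omega>. (\<Sum>k. indicator {..t} (T (Suc k) \<omega>)) \<partial>M) = (\<Sum>i\<in>UNIV. \<integral>\<^sup>+s\<in>{0..t}. mean_coord i s \<partial>lborel)"
    using expected_jump_sum[of "\<lambda>_. 1" t] by (simp add: nav.emeasure_space_1)
  also have "\<dots> < \<infinity>"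
    using integral_mean_finite by simp
  finally have "AE \<omega> in M. (\<Sum>k. indicator {..t} (T (Suc k) \<omega>)) \<noteq> (\<infinity> :: ennreal)"
    by (intro nn_integral_PInf_AE) auto
  then show ?thesis
  proof eventually_elim
    case (elim \<omega>)
    have "\<exists>k. t < T (Suc k) \<omega>"
    proof (rule ccontr)
      assume "\<not> ?thesis"
      then have "(\<lambda>k. indicator {..t} (T (Suc k) \<omega>)) = (\<lambda>k. 1 :: ennreal)"
        by (auto simp: not_less)
      then show False using elim suminf_ennreal_const_1 by simp
    qed
    define k where "k = (LEAST k. t < T (Suc k) \<omega>)"
    have "t < T (Suc k) \<omega>" unfolding k_def using \<open>\<exists>k. t < T (Suc k) \<omega>\<close> by (rule LeastI_ex)
    moreover have "T k \<omega> \<le> t"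
    proof (cases k)
      case 0
      then show ?thesis using assms by simp
    next
      case (Suc m)
      then have "m < (LEAST k. t < T (Suc k) \<omega>)" by (simp add: k_def)
      from not_less_Least[OF this] show ?thesis using Suc by simp
    qed
    ultimately show ?case by blast
  qed
qed

lemma position_on_stretch:
  assumes "0 \<le> t"
  shows "AE \<omega> in M. \<exists>k. strict_mono (\<lambda>n. T n \<omega>) \<and> T k \<omega> \<le> t \<and> t < T (Suc k) \<omega> \<and> X t \<omega> = S k \<omega>
    \<and> (\<forall>j. 0 \<le> S k \<omega> $ j)"
  using no_explosion[OF assms] time_strict_mono jump_process state_nonneg
  by eventually_elim blast

lemma expected_position:
  assumes "0 \<le> t"
  shows "(\<integral>\<^sup>+\<omega>. ennreal (X t \<omega> $ j) \<partial>M) = mean_coord j t"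
proof -
  have [measurable]: "(\<lambda>\<omega>. indicator {T k \<omega>..<T (Suc k) \<omega>} t :: ennreal) \<in> borel_measurable M" for k
    unfolding indicator_def by simp
  have "(\<integral>\<^sup>+\<omega>. ennreal (X t \<omega> $ j) \<partial>M) = (\<integral>\<^sup>+\<omega>. (\<Sum>k. ennreal (S k \<omega> $ j) * indicator {T k \<omega>..<T (Suc k) \<omega>} t) \<partial>M)"
  proof (rule nn_integral_cong_AE)
    show "AE \<omega> in M. ennreal (X t \<omega> $ j) = (\<Sum>k. ennreal (S k \<omega> $ j) * indicator {T k \<omega>..<T (Suc k) \<omega>} t)"
      using position_on_stretch[OF assms]
    proof eventually_elim
      case (elim \<omega>)
      then obtain k where k: "strict_mono (\<lambda>n. T n \<omega>)" "T k \<omega> \<le> t" "t < T (Suc k) \<omega>" "X t \<omega> = S k \<omega>" by blast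
      have "(\<Sum>l. ennreal (S l \<omega> $ j) * indicator {T l \<omega>..<T (Suc l) \<omega>} t)
          = (\<Sum>l\<in>{k}. ennreal (S l \<omega> $ j) * indicator {T l \<omega>..<T (Suc l) \<omega>} t)"
        by (intro suminf_finite) (auto simp: indicator_def dest: stretch_unique[OF k(1-3)])
      then show ?case using k by simp
    qed
  qed
  also have "\<dots> = mean_coord j t"
    unfolding mean_coord_def occupation_def by (intro nn_integral_suminf) measurable
  finally show ?thesis .
qed

text \<open>The jump sum \<open>X t = x0 + \<Sum>\<^sub>k R k\<close> over the renewals up to \<open>t\<close>, with negative parts moved to the left so
  that both sides consist of nonnegative terms and may be integrated term by term.\<close>
lemma mean_balance:
  assumes "0 \<le> t"
  shows "mean_coord j t + (\<Sum>i\<in>UNIV. (\<integral>\<^sup>+s\<in>{0..t}. mean_coord i s \<partial>lborel) * (\<integral>\<^sup>+\<eta>. ennreal (- A \<eta> $ i $ j) \<partial>N))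
    = ennreal (x0 $ j) + (\<Sum>i\<in>UNIV. (\<integral>\<^sup>+s\<in>{0..t}. mean_coord i s \<partial>lborel) * (\<integral>\<^sup>+\<eta>. ennreal (A \<eta> $ i $ j) \<partial>N))"
proof -
  note [measurable] = walk_measurable[OF assms]
  \<comment> \<open>The sign \<open>\<sigma> = \<plusminus> 1\<close> selects the positive or the negative part, as \<open>ennreal\<close> is \<open>0\<close> on negative numbers.\<close>
  let ?s = "\<lambda>\<sigma> \<omega>. \<Sum>k. indicator {..t} (T (Suc k) \<omega>) * ennreal (\<sigma> * R k \<omega> $ j)"
  have pos: "(\<integral>\<^sup>+\<omega>. ?s \<sigma> \<omega> \<partial>M) = (\<Sum>i\<in>UNIV. (\<integral>\<^sup>+s\<in>{0..t}. mean_coord i s \<partial>lborel) * (\<integral>\<^sup>+\<eta>. ennreal (\<sigma> * A \<eta> $ i $ j) \<partial>N))" for \<sigma>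
    by (rule expected_jump_sum) measurable
  have "(\<integral>\<^sup>+\<omega>. ennreal (X t \<omega> $ j) + ?s (-1) \<omega> \<partial>M) = (\<integral>\<^sup>+\<omega>. ennreal (x0 $ j) + ?s 1 \<omega> \<partial>M)"
  proof (rule nn_integral_cong_AE)
    show "AE \<omega> in M. ennreal (X t \<omega> $ j) + ?s (-1) \<omega> = ennreal (x0 $ j) + ?s 1 \<omega>"
      using position_on_stretch[OF assms]
    proof eventually_elim
      case (elim \<omega>)
      then obtain k where k: "strict_mono (\<lambda>n. T n \<omega>)" "T k \<omega> \<le> t" "t < T (Suc k) \<omega>" "X t \<omega> = S k \<omega>"
        and nonneg: "0 \<le> S k \<omega> $ j" by blast
      have s: "?s \<sigma> \<omega> = ennreal (\<Sum>l<k. max 0 (\<sigma> * R l \<omega> $ j))" for \<sigma>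
      proof -
        have "?s \<sigma> \<omega> = (\<Sum>l<k. indicator {..t} (T (Suc l) \<omega>) * ennreal (\<sigma> * R l \<omega> $ j))"
          using stretch_time_le[OF k(1-3)] by (intro suminf_finite) (auto simp: indicator_def)
        also have "\<dots> = (\<Sum>l<k. ennreal (max 0 (\<sigma> * R l \<omega> $ j)))"
          using stretch_time_le[OF k(1-3)] by (intro sum.cong) (auto simp: indicator_def max_def ennreal_neg)
        also have "\<dots> = ennreal (\<Sum>l<k. max 0 (\<sigma> * R l \<omega> $ j))"
          by (intro sum_ennreal) simp
        finally show ?thesis .
      qed
      have "S k \<omega> $ j + (\<Sum>l<k. max 0 (- 1 * R l \<omega> $ j)) = x0 $ j + (\<Sum>l<k. R l \<omega> $ j + max 0 (- 1 * R l \<omega> $ j))"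
        by (simp add: renewal_state_def sum_component sum.distrib)
      also have "\<dots> = x0 $ j + (\<Sum>l<k. max 0 (1 * R l \<omega> $ j))"
        by (intro arg_cong2[where f = "(+)"] refl sum.cong) (auto simp: max_def)
      finally have eq: "S k \<omega> $ j + (\<Sum>l<k. max 0 (- 1 * R l \<omega> $ j)) = x0 $ j + (\<Sum>l<k. max 0 (1 * R l \<omega> $ j))" .
      have "ennreal (S k \<omega> $ j) + ennreal (\<Sum>l<k. max 0 (- 1 * R l \<omega> $ j))
          = ennreal (S k \<omega> $ j + (\<Sum>l<k. max 0 (- 1 * R l \<omega> $ j)))"
        using nonneg by (intro ennreal_plus[symmetric] sum_nonneg) auto
      also have "\<dots> = ennreal (x0 $ j) + ennreal (\<Sum>l<k. max 0 (1 * R l \<omega> $ j))"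
        unfolding eq using start_nonneg by (intro ennreal_plus sum_nonneg) auto
      finally show ?case unfolding s k(4) .
    qed
  qed
  then have "mean_coord j t + (\<integral>\<^sup>+\<omega>. ?s (-1) \<omega> \<partial>M) = ennreal (x0 $ j) + (\<integral>\<^sup>+\<omega>. ?s 1 \<omega> \<partial>M)"
    unfolding expected_position[OF assms, symmetric]
    by (simp add: nn_integral_add walk.emeasure_space_1)
  then show ?thesis unfolding pos by simp
qed

lemma mean_real: 
  assumes "0 \<le> t"
  shows "ennreal (enn2real (mean_coord i t)) = mean_coord i t"
  using mean_le[OF assms, of i] by (intro ennreal_enn2real) (auto simp: less_top[symmetric] top_unique)

lemma mean_integrable: "set_integrable lborel {0..t} (\<lambda>s. enn2real (mean_coord i s))"
  and integral_mean: "ennreal (LINT s:{0..t}|lborel. enn2real (mean_coord i s)) = (\<integral>\<^sup>+s\<in>{0..t}. mean_coord i s \<partial>lborel)"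
proof -
  have eq: "(\<integral>\<^sup>+s. ennreal (indicator {0..t} s *\<^sub>R enn2real (mean_coord i s)) \<partial>lborel) = (\<integral>\<^sup>+s\<in>{0..t}. mean_coord i s \<partial>lborel)"
    by (intro nn_integral_cong) (auto simp: indicator_def mean_real)
  show int: "set_integrable lborel {0..t} (\<lambda>s. enn2real (mean_coord i s))"
    unfolding set_integrable_def
    using eq integral_mean_finite[of i t] by (intro integrableI_nonneg) auto
  then show "ennreal (LINT s:{0..t}|lborel. enn2real (mean_coord i s)) = (\<integral>\<^sup>+s\<in>{0..t}. mean_coord i s \<partial>lborel)"
    unfolding eq[symmetric] set_integrable_def set_lebesgue_integral_def
    by (intro nn_integral_eq_integral[symmetric]) auto
qed

lemma mean_integral_equation:
  assumes "0 \<le> t"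
  shows "enn2real (mean_coord j t) = x0 $ j
    + (\<Sum>i\<in>UNIV. (\<integral>\<eta>. A \<eta> $ i $ j \<partial>N) * (LINT s:{0..t}|lborel. enn2real (mean_coord i s)))"
proof -
  let ?I = "\<lambda>i. LINT s:{0..t}|lborel. enn2real (mean_coord i s)"
  have I0: "0 \<le> ?I i" for i
    unfolding set_lebesgue_integral_def by (intro Bochner_Integration.integral_nonneg) simp
  define p where "p \<sigma> i = enn2real (\<integral>\<^sup>+\<eta>. ennreal (\<sigma> * A \<eta> $ i $ j) \<partial>N)" for \<sigma> i
  have p: "(\<integral>\<^sup>+\<eta>. ennreal (\<sigma> * A \<eta> $ i $ j) \<partial>N) = ennreal (p \<sigma> i)" for \<sigma> i
  proof -
    have "(\<integral>\<^sup>+\<eta>. ennreal (\<sigma> * A \<eta> $ i $ j) \<partial>N) \<le> (\<integral>\<^sup>+\<eta>. ennreal (norm (\<sigma> * A \<eta> $ i $ j)) \<partial>N)"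
      by (intro nn_integral_mono ennreal_leI) simp
    also have "\<dots> < \<infinity>"
      using integrable_mult_right[OF rows_integrable, of \<sigma> i j] unfolding integrable_iff_bounded by blast
    finally show ?thesis unfolding p_def by (simp add: ennreal_enn2real)
  qed
  have p0: "0 \<le> p \<sigma> i" for \<sigma> i by (simp add: p_def)
  have mean_diff: "(\<integral>\<eta>. A \<eta> $ i $ j \<partial>N) = p 1 i - p (- 1) i" for i
    unfolding p_def by (subst real_lebesgue_integral_def[OF rows_integrable]) simp
  have "ennreal (enn2real (mean_coord j t) + (\<Sum>i\<in>UNIV. ?I i * p (- 1) i)) = ennreal (x0 $ j + (\<Sum>i\<in>UNIV. ?I i * p 1 i))"
  proof -
    have s: "(\<Sum>i\<in>UNIV. (\<integral>\<^sup>+s\<in>{0..t}. mean_coord i s \<partial>lborel) * (\<integral>\<^sup>+\<eta>. ennreal (\<sigma> * A \<eta> $ i $ j) \<partial>N))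
        = ennreal (\<Sum>i\<in>UNIV. ?I i * p \<sigma> i)" for \<sigma>
      unfolding p integral_mean[symmetric] using I0 p0
      by (subst sum_ennreal[symmetric]) (auto simp: ennreal_mult)
    show ?thesis
      using mean_balance[OF assms, of j] s[of "-1"] s[of 1] start_nonneg[of j] mean_real[OF assms, of j] I0 p0
      by (simp add: ennreal_plus sum_nonneg)
  qed
  then have "enn2real (mean_coord j t) + (\<Sum>i\<in>UNIV. ?I i * p (- 1) i) = x0 $ j + (\<Sum>i\<in>UNIV. ?I i * p 1 i)"
    using I0 p0 start_nonneg by (subst (asm) ennreal_inj) (auto intro!: add_nonneg_nonneg sum_nonneg)
  then show ?thesis
    unfolding mean_diff by (simp add: left_diff_distrib sum_subtractf mult.commute)
qed

lemma expected_walk: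
  assumes "0 \<le> t"
  shows "(\<forall>j. integrable M (\<lambda>\<omega>. X t \<omega> $ j)) \<and>
    mean_vec M (X t) = mat_exp (t *\<^sub>R mean_mat N (\<lambda>\<eta>. transpose (A \<eta>))) *v x0"
proof
  note [measurable] = walk_measurable[OF assms]
  have nonneg: "AE \<omega> in M. 0 \<le> X t \<omega> $ j" for j
    using position_on_stretch[OF assms] by eventually_elim auto
  have fin: "(\<integral>\<^sup>+\<omega>. ennreal (X t \<omega> $ j) \<partial>M) < \<infinity>" for j
    unfolding expected_position[OF assms] by (rule le_less_trans[OF mean_le[OF assms]]) simp
  show "\<forall>j. integrable M (\<lambda>\<omega>. X t \<omega> $ j)"
    using nonneg fin by (intro allI integrableI_nonneg) auto
  let ?g = "\<lambda>s. \<chi> i. enn2real (mean_coord i s)"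
  have "mean_vec M (X t) = ?g t"
    unfolding mean_vec_def vec_eq_iff
    using nonneg by (simp add: integral_eq_nn_integral expected_position[OF assms])
  also have "\<dots> = mat_exp (t *\<^sub>R mean_mat N (\<lambda>\<eta>. transpose (A \<eta>))) *v x0"
  proof (rule linear_integral_equation_solution[OF _ _ _ assms order_refl])
    show "set_integrable lborel {0..s} (\<lambda>s. ?g s $ i)" for i s
      using mean_integrable by simp
    show "\<bar>?g s $ i\<bar> \<le> 2 * total x0 * exp (2 * jump_bound * t)" if "0 \<le> s" "s \<le> t" for i s
      using enn2real_mono[OF mean_le_on_interval[OF that]] total_start_nonneg by simp
    show "?g s $ j = x0 $ j + (\<Sum>i\<in>UNIV. mean_mat N (\<lambda>\<eta>. transpose (A \<eta>)) $ j $ i *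
        (LINT s:{0..s}|lborel. ?g s $ i))" if "0 \<le> s" for j s
      using mean_integral_equation[OF that, of j] by (simp add: mean_mat_def transpose_def)
  qed
  finally show "mean_vec M (X t) = mat_exp (t *\<^sub>R mean_mat N (\<lambda>\<eta>. transpose (A \<eta>))) *v x0" .
qed

end

section \<open>The mean of the walk\<close>

theorem theorem4p1:
  fixes M :: "'a measure" and N :: "'b measure"
    and A :: "'b \<Rightarrow> real^'c^'c" and x0 :: "real^'c"
    and F :: "nat \<Rightarrow> 'a measure" and W :: "nat \<Rightarrow> 'a \<Rightarrow> real"
    and J :: "nat \<Rightarrow> 'a \<Rightarrow> 'c" and R :: "nat \<Rightarrow> 'a \<Rightarrow> real^'c"
    and X :: "real \<Rightarrow> 'a \<Rightarrow> real^'c" and t :: real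
  assumes "polya_walk M N A x0 F W J R X"
    and "tenable M x0 R"
    and "row_mgfs_finite_near_0 N A"
    and "0 \<le> t"
  shows "(\<forall>j. integrable M (\<lambda>\<omega>. X t \<omega> $ j)) \<and>
    mean_vec M (X t) = mat_exp (t *\<^sub>R mean_mat N (\<lambda>\<eta>. transpose (A \<eta>))) *v x0"
proof -
  interpret polya_walk M N A x0 F W J R X by (rule assms(1))
  interpret integrable_polya_walk M N A x0 F W J R X
    by unfold_locales (rule assms(2), rule integrable_entry_if_mgf_finite[OF nav_measurable assms(3)])
  show ?thesis by (rule expected_walk[OF assms(4)])
qed

end
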